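(* Let $1<\delta<2$. Let $b,c,f\in C^{q,\mu}(0,1]$ for some integer $q\ge2$ and some $\mu\le 2-\delta$. Let $\alpha_0,\alpha_1,\gamma_0,\gamma_1$ be real constants. Assume that $c\ge0$ on $[0,1]$, $\alpha_1\ge0$ and $\alpha_0\ge\frac1{\delta-1}$. Then the boundary value problem $$-D_*^\delta u(x)+b(x)u'(x)+c(x)u(x)=f(x)\ \text{ for }x\in(0,1),$$ $$u(0)-\alpha_0u'(0)=\gamma_0,\qquad u(1)+\alpha_1u'(1)=\gamma_1,$$ has a unique solution $u$ with $u\in C^1[0,1]\cap C^{q+1}(0,1]$, and there exists a constant $C$, independent of $x$, such that for all $x\in(0,1]$ $$|u^{(i)}(x)|\le\begin{cases}C&\text{if } i=0,1,\\ Cx^{\delta-i}&\text{if } i=2,3,\dots,q+1.\end{cases}$$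
   Context: For $1<\delta<2$, the Caputo fractional derivative is $D_*^\delta g = D^\delta[g-T_1[g;0]]$, where $T_1[g;0](x)=g(0)+g'(0)x$ and $D^\delta$ is the Riemann-Liouville derivative $$D^\delta w(x)=\left(\frac{d}{dx}\right)^2\left[\frac{1}{\Gamma(2-\delta)}\int_0^x(x-t)^{1-\delta}w(t)\,dt\right],\quad 0<x\le 1,$$ for all $w$ for which this exists. For an integer $q\ge1$ and $\nu\in(-\infty,1)$, $C^{q,\nu}(0,1]$ is the set of continuous functions $y:[0,1]\to\mathbb{R}$ that are $q$ times continuously differentiable in $(0,1]$ and for which there is a constant $C$ with, for all $0<x\le1$ and $i=1,2,\dots,q$, $$|y^{(i)}(x)|\le\begin{cases}C&\text{if } i<1-\nu,\\ C(1+|\ln x|)&\text{if } i=1-\nu,\\ Cx^{1-\nu-i}&\text{if } i>1-\nu.\end{cases}$$ $C^k(I)$ denotes the real-valued functions whose derivatives up to order $k$ are continuous on the interval $I$. *)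

theory Defs
  imports "HOL-Analysis.Analysis"
begin

(* Derivatives are taken relative to the interval S, hence one-sided at an endpoint
   belonging to S; values of functions outside S play no role. *)
definition nth_deriv_on :: "real set \<Rightarrow> nat \<Rightarrow> (real \<Rightarrow> real) \<Rightarrow> real \<Rightarrow> real" where
  "nth_deriv_on S k g = ((\<lambda>h x. vector_derivative h (at x within S)) ^^ k) g"

definition Ck :: "nat \<Rightarrow> real set \<Rightarrow> (real \<Rightarrow> real) set" where
  "Ck k S = {g. (\<forall>j<k. nth_deriv_on S j g differentiable_on S) \<and>
                (\<forall>j\<le>k. continuous_on S (nth_deriv_on S j g))}"

definition Cq_weighted :: "nat \<Rightarrow> real \<Rightarrow> (real \<Rightarrow> real) set" where
  "Cq_weighted q \<nu> = {y. continuous_on {0..1} y \<and> y \<in> Ck q {0<..1} \<and>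
     (\<exists>C. \<forall>x\<in>{0<..1}. \<forall>i\<in>{1..q}.
        \<bar>nth_deriv_on {0<..1} i y x\<bar> \<le>
          (if real i < 1 - \<nu> then C
           else if real i = 1 - \<nu> then C * (1 + \<bar>ln x\<bar>)
           else C * x powr (1 - \<nu> - real i)))}"

definition RL_kernel :: "real \<Rightarrow> (real \<Rightarrow> real) \<Rightarrow> real \<Rightarrow> real \<Rightarrow> real" where
  "RL_kernel \<delta> w x t = (x - t) powr (1 - \<delta>) * w t"

definition RL_integral :: "real \<Rightarrow> (real \<Rightarrow> real) \<Rightarrow> real \<Rightarrow> real" where
  "RL_integral \<delta> w x = 1 / Gamma (2 - \<delta>) * integral {0..x} (RL_kernel \<delta> w x)"

definition RL_deriv :: "real \<Rightarrow> (real \<Rightarrow> real) \<Rightarrow> real \<Rightarrow> real" where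
  "RL_deriv \<delta> w x = nth_deriv_on {0<..1} 2 (RL_integral \<delta> w) x"

(* Existence of the Riemann-Liouville derivative at x. Since integral and vector_derivative
   are total functions, an equation involving RL_deriv has to be accompanied by this
   condition. Absolute integrability makes the integral a Lebesgue integral. *)
definition RL_differentiable :: "real \<Rightarrow> (real \<Rightarrow> real) \<Rightarrow> real \<Rightarrow> bool" where
  "RL_differentiable \<delta> w x \<longleftrightarrow>
     (\<forall>\<^sub>F y in nhds x. y \<in> {0<..1} \<longrightarrow>
        RL_kernel \<delta> w y absolutely_integrable_on {0..y} \<and>
        RL_integral \<delta> w differentiable (at y within {0<..1})) \<and>
     nth_deriv_on {0<..1} 1 (RL_integral \<delta> w) differentiable (at x within {0<..1})"

definition taylor1_at_0 :: "(real \<Rightarrow> real) \<Rightarrow> real \<Rightarrow> real" where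
  "taylor1_at_0 g x = g 0 + nth_deriv_on {0..1} 1 g 0 * x"

definition caputo_deriv :: "real \<Rightarrow> (real \<Rightarrow> real) \<Rightarrow> real \<Rightarrow> real" where
  "caputo_deriv \<delta> g = RL_deriv \<delta> (\<lambda>t. g t - taylor1_at_0 g t)"

definition caputo_differentiable :: "real \<Rightarrow> (real \<Rightarrow> real) \<Rightarrow> real \<Rightarrow> bool" where
  "caputo_differentiable \<delta> g x \<longleftrightarrow>
     g differentiable (at 0 within {0..1}) \<and>
     RL_differentiable \<delta> (\<lambda>t. g t - taylor1_at_0 g t) x"

definition caputo_bvp_solution ::
  "real \<Rightarrow> (real \<Rightarrow> real) \<Rightarrow> (real \<Rightarrow> real) \<Rightarrow> (real \<Rightarrow> real) \<Rightarrow>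
   real \<Rightarrow> real \<Rightarrow> real \<Rightarrow> real \<Rightarrow> (real \<Rightarrow> real) \<Rightarrow> bool" where
  "caputo_bvp_solution \<delta> b c f \<alpha>0 \<alpha>1 \<gamma>0 \<gamma>1 u \<longleftrightarrow>
     (\<forall>x\<in>{0<..<1}. caputo_differentiable \<delta> u x \<and>
        - caputo_deriv \<delta> u x + b x * nth_deriv_on {0..1} 1 u x + c x * u x = f x) \<and>
     u 0 - \<alpha>0 * nth_deriv_on {0..1} 1 u 0 = \<gamma>0 \<and>
     u 1 + \<alpha>1 * nth_deriv_on {0..1} 1 u 1 = \<gamma>1"

end

theory Submission
  imports Defs
begin

text \<open>
  Write \<beta> = \<delta> - 1, J^a for the Riemann-Liouville fractional integral of order a, and v for u'.
  Since J^a J^b = J^(a+b), applying J^(1-\<beta>) and differentiating undoes J^\<beta>, and the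
  differential equation is equivalent to the integral equation
    v = v(0) + J^\<beta> (b v + c u - f),   u = u(0) + J^1 v
  (\<open>caputo_volterra_iff\<close>). As an equation for v alone it reads v = h + T v, where
  T d = J^\<beta> (b d + c J^1 d) and h depends linearly on u(0), v(0) and f.

  Everything quantitative is done in one scale of spaces, described by \<open>euler_class\<close>: all powers up
  to q of the Euler operator \<theta> = x d/dx map the function to a continuous function on [0,1] that is
  bounded by K x^(n \<beta>). This scale fits the problem because \<theta> commutes with dilations, and
  J^a g (x) is x^a times an average of dilates of g. So J^\<beta> maps weight n to weight n + 1 without
  loss of derivatives, and its norm between these spaces tends to 0 as n grows
  (\<open>euler_class_frac_int\<close>, \<open>node_moment_tendsto_0\<close>). Hence the Neumann series of 1 - T converges,
  with all its Euler derivatives, for every choice of initial values (\<open>volterra_solution_exists\<close>),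
  and its sum is the only continuous solution (\<open>volterra_homogeneous_unique\<close>).

  The coefficients lie in this scale because \<mu> \<le> 1 - \<beta> turns the hypotheses on y^(i) into
  |x^i y^(i)| \<le> C x^\<beta> (\<open>Cq_weighted_imp_euler_class\<close>). Conversely v - v(0) is a value of J^\<beta>, so
  it has weight 1, and writing v^(i) as x^(-i) times a combination of \<theta> v, ..., \<theta>^i v gives
  |u^(i+1)| \<le> C x^(\<beta> - i) (\<open>euler_class_primitive_regular\<close>).

  It remains to see that the boundary conditions fix the initial values. The solutions that obey
  the left condition form the line u_p + s u_w, where u_p starts with u(0) = \<gamma>0, u'(0) = 0, and u_w
  solves the equation for f = 0 with u(0) = \<alpha>0, u'(0) = 1. The right condition is a linear equation
  for s with slope u_w(1) + \<alpha>1 u_w'(1), so it has exactly one solution once w = u_w' is positive on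
  [0,1]. Suppose that w has a first zero z. On [0,z] both w and u_w are nonnegative. Applying
  J^(1-\<beta>) to the integral equation and differentiating at z gives
    (J^(1-\<beta>) w)'(z) = z^(-\<beta>) / \<Gamma>(1-\<beta>) + c(z) u_w(z) > 0,
  whereas formally (J^(1-\<beta>) w)'(z) is -\<beta> / \<Gamma>(1-\<beta>) times the integral of
  (z - t)^(-\<beta>-1) w(t) over [0,z] and hence at most 0
  (\<open>frac_int_derivative_at_first_zero\<close>, \<open>volterra_solution_positive\<close>).
\<close>

section \<open>Functions with bounded Euler derivatives\<close>

text \<open>
  The recursion runs over \<theta> = x d/dx: the witness h of the successor step is \<theta> g on (0,1], and
  h 0 = 0 together with the continuity of h says that \<theta> g tends to 0 at
  the origin. One constant K
  serves for all \<theta>^i g with i \<le> q, so that it behaves like a norm.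
\<close>

primrec euler_class :: "real \<Rightarrow> nat \<Rightarrow> nat \<Rightarrow> real \<Rightarrow> (real \<Rightarrow> real) \<Rightarrow> bool" where
  "euler_class \<beta> n 0 K g \<longleftrightarrow>
     continuous_on {0..1} g \<and> (\<forall>x\<in>{0..1}. \<bar>g x\<bar> \<le> K * (x powr \<beta>) ^ n)"
| "euler_class \<beta> n (Suc q) K g \<longleftrightarrow>
     continuous_on {0..1} g \<and> (\<forall>x\<in>{0..1}. \<bar>g x\<bar> \<le> K * (x powr \<beta>) ^ n) \<and>
     (\<exists>h. h 0 = 0 \<and> (\<forall>x\<in>{0<..1}. (g has_real_derivative h x / x) (at x within {0<..1})) \<and>
          euler_class \<beta> n q K h)"

lemma euler_class_continuous: "euler_class \<beta> n q K g \<Longrightarrow> continuous_on {0..1} g"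
  by (cases q) auto

lemma euler_class_bound:
  "euler_class \<beta> n q K g \<Longrightarrow> x \<in> {0..1} \<Longrightarrow> \<bar>g x\<bar> \<le> K * (x powr \<beta>) ^ n"
  by (cases q) auto

lemma euler_class_nonneg: "euler_class \<beta> n q K g \<Longrightarrow> 0 \<le> K"
  using euler_class_bound[of \<beta> n q K g 1] by auto

lemma euler_class_SucD: "euler_class \<beta> n (Suc q) K g \<Longrightarrow> euler_class \<beta> n q K g"
proof (induction q arbitrary: g)
  case (Suc q)
  from Suc.prems obtain h where "h 0 = 0" "euler_class \<beta> n (Suc q) K h"
    "\<forall>x\<in>{0<..1}. (g has_real_derivative h x / x) (at x within {0<..1})"
    unfolding euler_class.simps(2)[of \<beta> n "Suc q"] by blast
  moreover from this(2) have "euler_class \<beta> n q K h" by (rule Suc.IH)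
  ultimately show ?case using Suc.prems unfolding euler_class.simps(2) by blast
qed auto

lemma euler_class_mono_order: "euler_class \<beta> n q K g \<Longrightarrow> m \<le> q \<Longrightarrow> euler_class \<beta> n m K g"
  by (induction q) (use euler_class_SucD le_Suc_eq in blast)+

lemma euler_class_mono_const: "euler_class \<beta> n q K g \<Longrightarrow> K \<le> L \<Longrightarrow> euler_class \<beta> n q L g"
proof (induction q arbitrary: g)
  have *: "\<bar>g x\<bar> \<le> L * (x powr \<beta>) ^ n"
    if "euler_class \<beta> n q K g" "K \<le> L" "x \<in> {0..1}" for q g x
    using euler_class_bound[OF that(1,3)] mult_right_mono[OF \<open>K \<le> L\<close>, of "(x powr \<beta>) ^ n"]
    by (meson order.trans zero_le_power powr_ge_zero)
  {
    case 0
    then show ?case using *[OF 0] by simp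
  next
    case (Suc q)
    then show ?case using *[OF Suc.prems] by auto
  }
qed

lemma euler_class_cong:
  assumes "euler_class \<beta> n q K f" "\<And>x. x \<in> {0..1} \<Longrightarrow> g x = f x"
  shows "euler_class \<beta> n q K g"
proof -
  have cont: "continuous_on {0..1} g"
    by (rule continuous_on_eq[OF euler_class_continuous[OF assms(1)]]) (rule assms(2)[symmetric])
  show ?thesis
  proof (cases q)
    case 0
    then show ?thesis using assms cont by simp
  next
    case (Suc p)
    with assms(1) obtain h where h: "h 0 = 0" "euler_class \<beta> n p K h"
      "\<And>x. x \<in> {0<..1} \<Longrightarrow> (f has_real_derivative h x / x) (at x within {0<..1})" by auto
    have "(g has_real_derivative h x / x) (at x within {0<..1})" if "x \<in> {0<..1}" for x
      by (rule has_field_derivative_transform_within[OF h(3)[OF that], of 1]) (use that assms(2) in auto)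
    then show ?thesis
      unfolding Suc euler_class.simps using cont h(1,2) assms(2) euler_class_bound[OF assms(1)] by auto
  qed
qed

lemma powr_unit_interval: "0 \<le> (x::real) \<Longrightarrow> x \<le> 1 \<Longrightarrow> 0 \<le> \<beta> \<Longrightarrow> x powr \<beta> \<le> 1"
  by (simp add: powr_le1)

lemma euler_class_weight_0:
  assumes "0 \<le> \<beta>" shows "euler_class \<beta> n q K g \<Longrightarrow> euler_class \<beta> 0 q K g"
proof (induction q arbitrary: g)
  have *: "\<bar>g x\<bar> \<le> K" if "\<bar>g x\<bar> \<le> K * (x powr \<beta>) ^ n" "x \<in> {0..1}" "0 \<le> K" for x :: real and g
  proof -
    have "(x powr \<beta>) ^ n \<le> 1" using that assms by (auto intro!: power_le_one powr_unit_interval)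
    from mult_left_mono[OF this \<open>0 \<le> K\<close>] that show ?thesis by simp
  qed
  {
    case 0
    then show ?case using * euler_class_nonneg[OF 0] by auto
  next
    case (Suc q)
    then show ?case using * euler_class_nonneg[OF Suc.prems] by auto
  }
qed

lemma euler_class_add:
  "euler_class \<beta> n q K f \<Longrightarrow> euler_class \<beta> n q L g \<Longrightarrow> euler_class \<beta> n q (K + L) (\<lambda>x. f x + g x)"
proof (induction q arbitrary: f g)
  case 0
  have "\<bar>f x + g x\<bar> \<le> (K + L) * (x powr \<beta>) ^ n" if "x \<in> {0..1}" for x
    using euler_class_bound[OF 0(1) that] euler_class_bound[OF 0(2) that]
    by (simp add: distrib_right)
  then show ?case using 0 by (auto intro!: continuous_intros)
next
  case (Suc q)
  from Suc.prems obtain f' g' where d: "f' 0 = 0" "g' 0 = 0"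
    "\<And>x. x \<in> {0<..1} \<Longrightarrow> (f has_real_derivative f' x / x) (at x within {0<..1})"
    "\<And>x. x \<in> {0<..1} \<Longrightarrow> (g has_real_derivative g' x / x) (at x within {0<..1})"
    "euler_class \<beta> n q K f'" "euler_class \<beta> n q L g'" by auto
  have "((\<lambda>x. f x + g x) has_real_derivative (f' x + g' x) / x) (at x within {0<..1})"
    if "x \<in> {0<..1}" for x
    using DERIV_add[OF d(3,4)[OF that]] by (simp add: add_divide_distrib)
  moreover have "\<bar>f x + g x\<bar> \<le> (K + L) * (x powr \<beta>) ^ n" if "x \<in> {0..1}" for x
    using euler_class_bound[OF Suc.prems(1) that] euler_class_bound[OF Suc.prems(2) that]
    by (simp add: distrib_right)
  ultimately show ?case
    using Suc.IH[OF d(5,6)] d(1,2) Suc.prems[THEN euler_class_continuous]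
    by (auto intro!: continuous_intros exI[of _ "\<lambda>x. f' x + g' x"])
qed

text \<open>
  The factor 2^q counts the terms of the Leibniz rule for \<theta>^q.
\<close>

lemma euler_class_mult:
  "euler_class \<beta> m q K f \<Longrightarrow> euler_class \<beta> n q L g \<Longrightarrow>
   euler_class \<beta> (m + n) q (2 ^ q * (K * L)) (\<lambda>x. f x * g x)"
proof (induction q arbitrary: f g)
  have *: "\<bar>f x * g x\<bar> \<le> K * L * (x powr \<beta>) ^ (m + n)"
    if "euler_class \<beta> m q K f" "euler_class \<beta> n q L g" "x \<in> {0..1}" for q x f g
  proof -
    have "\<bar>f x\<bar> * \<bar>g x\<bar> \<le> (K * (x powr \<beta>) ^ m) * (L * (x powr \<beta>) ^ n)"
      using that euler_class_nonneg by (intro mult_mono euler_class_bound) auto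
    then show ?thesis by (simp add: abs_mult power_add mult_ac)
  qed
  {
    case 0
    then show ?case using *[OF 0] by (auto intro!: continuous_intros)
  next
    case (Suc q)
    from Suc.prems obtain f' g' where d: "f' 0 = 0" "g' 0 = 0"
      "\<And>x. x \<in> {0<..1} \<Longrightarrow> (f has_real_derivative f' x / x) (at x within {0<..1})"
      "\<And>x. x \<in> {0<..1} \<Longrightarrow> (g has_real_derivative g' x / x) (at x within {0<..1})"
      "euler_class \<beta> m q K f'" "euler_class \<beta> n q L g'" by auto
    have der: "((\<lambda>x. f x * g x) has_real_derivative (f' x * g x + f x * g' x) / x) (at x within {0<..1})"
      if "x \<in> {0<..1}" for x
      using DERIV_mult[OF d(3,4)[OF that]] by (simp add: add_divide_distrib mult_ac add_ac)
    have K0: "0 \<le> K * L" using Suc.prems[THEN euler_class_nonneg] by simp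
    have "K * L \<le> 2 ^ Suc q * (K * L)" using mult_right_mono[OF _ K0, of 1 "2 ^ Suc q"]
      by (metis mult_1 one_le_numeral one_le_power)
    then have bd: "\<bar>f x * g x\<bar> \<le> 2 ^ Suc q * (K * L) * (x powr \<beta>) ^ (m + n)" if "x \<in> {0..1}" for x
      using *[OF Suc.prems that] mult_right_mono[of "K * L" "2 ^ Suc q * (K * L)" "(x powr \<beta>) ^ (m + n)"]
      by fastforce
    have "euler_class \<beta> (m + n) q (2 ^ q * (K * L) + 2 ^ q * (K * L)) (\<lambda>x. f' x * g x + f x * g' x)"
      using Suc.IH[OF d(5) Suc.prems(2)[THEN euler_class_SucD]]
        Suc.IH[OF Suc.prems(1)[THEN euler_class_SucD] d(6)] by (rule euler_class_add)
    then have ih: "euler_class \<beta> (m + n) q (2 ^ Suc q * (K * L)) (\<lambda>x. f' x * g x + f x * g' x)"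
      by (simp add: algebra_simps)
    show ?case unfolding euler_class.simps
      using d(1,2) der bd ih Suc.prems[THEN euler_class_continuous]
      by (intro conjI exI[of _ "\<lambda>x. f' x * g x + f x * g' x"]) (auto intro!: continuous_intros)
  }
qed

lemma euler_class_const: "\<bar>a\<bar> \<le> K \<Longrightarrow> euler_class \<beta> 0 q K (\<lambda>x. a)"
  by (induction q arbitrary: a) (auto intro!: continuous_intros exI[of _ "\<lambda>x. 0"] derivative_eq_intros)

lemma euler_class_cmult:
  assumes "euler_class \<beta> n q K g"
  shows "euler_class \<beta> n q (\<bar>a\<bar> * K) (\<lambda>x. a * g x)"
  using assms
proof (induction q arbitrary: g)
  have *: "\<bar>a * g x\<bar> \<le> \<bar>a\<bar> * K * (x powr \<beta>) ^ n"
    if "euler_class \<beta> n q K g" "x \<in> {0..1}" for q x g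
    using mult_left_mono[OF euler_class_bound[OF that], of "\<bar>a\<bar>"] by (simp add: abs_mult)
  {
    case 0
    then show ?case using *[OF 0] by (auto intro!: continuous_intros)
  next
    case (Suc q)
    from Suc.prems obtain g' where d: "g' 0 = 0"
      "\<And>x. x \<in> {0<..1} \<Longrightarrow> (g has_real_derivative g' x / x) (at x within {0<..1})"
      "euler_class \<beta> n q K g'" by auto
    have "((\<lambda>x. a * g x) has_real_derivative (a * g' x) / x) (at x within {0<..1})"
      if "x \<in> {0<..1}" for x
      using DERIV_cmult[OF d(2)[OF that], of a] by simp
    then show ?case unfolding euler_class.simps
      using d(1) *[OF Suc.prems] Suc.IH[OF d(3)] Suc.prems[THEN euler_class_continuous]
      by (intro conjI exI[of _ "\<lambda>x. a * g' x"]) (auto intro!: continuous_intros)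
  }
qed

lemma euler_class_id: "euler_class \<beta> 0 q 1 (\<lambda>x. x)"
  by (induction q) (auto intro!: continuous_intros exI[of _ "\<lambda>x. x"] derivative_eq_intros)

lemma euler_class_powr:
  assumes "0 < \<beta>" "\<beta> \<le> 1"
  shows "euler_class \<beta> 1 q 1 (\<lambda>x. x powr \<beta>)"
proof (induction q)
  case 0
  then show ?case using assms by (auto intro!: continuous_intros continuous_on_powr')
next
  case (Suc q)
  have "euler_class \<beta> 1 q 1 (\<lambda>x. \<beta> * x powr \<beta>)"
    using euler_class_mono_const[OF euler_class_cmult[OF Suc, of \<beta>], of 1] assms by simp
  moreover have "((\<lambda>x. x powr \<beta>) has_real_derivative (\<beta> * x powr \<beta>) / x) (at x within {0<..1})"
    if "x \<in> {0<..1}" for x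
    using that by (auto intro!: derivative_eq_intros simp: powr_diff)
  ultimately show ?case using assms 
    by (auto intro!: continuous_intros continuous_on_powr' exI[of _ "\<lambda>x. \<beta> * x powr \<beta>"])
qed

section \<open>Averages over dilations and uniformly convergent series\<close>

lemma unit_interval_mult: "x \<in> {0..1} \<Longrightarrow> y \<in> {0..1} \<Longrightarrow> x * y \<in> {0..1::real}"
  by (auto simp: mult_le_one)

lemma dilation_mean_continuous:
  fixes g \<phi> :: "real \<Rightarrow> real"
  assumes \<phi>: "continuous_on {0..1} \<phi>" "\<And>t. t \<in> {0..1} \<Longrightarrow> \<phi> t \<in> {0..1}"
    and g: "continuous_on {0..1} g"
  shows "continuous_on {0..1} (\<lambda>x. integral {0..1} (\<lambda>t. g (x * \<phi> t)))"
proof -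
  have "continuous_on ({0..1} \<times> {0..1}) (\<lambda>(x, t). g (x * \<phi> t))"
    unfolding split_beta
  proof (rule continuous_on_compose2[OF g])
    show "continuous_on ({0..1} \<times> {0..1}) (\<lambda>p. fst p * \<phi> (snd p))"
      by (intro continuous_on_mult continuous_on_fst continuous_on_snd continuous_on_id
          continuous_on_compose2[OF \<phi>(1)]) auto
    show "(\<lambda>p. fst p * \<phi> (snd p)) ` ({0..1} \<times> {0..1}) \<subseteq> {0..1}"
      using unit_interval_mult[OF _ \<phi>(2)] by force
  qed
  then show ?thesis using integral_continuous_on_param[of "{0..1}" 0 1 "\<lambda>x t. g (x * \<phi> t)"] by simp
qed

lemma dilation_integrand_continuous:
  fixes g \<phi> :: "real \<Rightarrow> real"
  assumes \<phi>: "continuous_on {0..1} \<phi>" "\<And>t. t \<in> {0..1} \<Longrightarrow> \<phi> t \<in> {0..1}"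
    and g: "continuous_on {0..1} g" and x: "x \<in> {0..1}"
  shows "continuous_on {0..1} (\<lambda>t. g (x * \<phi> t))"
proof (rule continuous_on_compose2[OF g])
  show "continuous_on {0..1} (\<lambda>t. x * \<phi> t)" by (intro continuous_on_mult continuous_on_const \<phi>(1))
  show "(\<lambda>t. x * \<phi> t) ` {0..1} \<subseteq> {0..1}" using unit_interval_mult[OF x \<phi>(2)] by blast
qed

lemma powr_power_continuous:
  assumes "continuous_on {0..1} \<phi>" and \<phi>: "\<And>t. t \<in> {0..1} \<Longrightarrow> \<phi> t \<in> {0..1::real}" and "0 < \<beta>"
  shows "continuous_on {0..1} (\<lambda>t::real. (\<phi> t powr \<beta>) ^ n)"
proof -
  have "0 \<le> \<phi> t" if "t \<in> {0..1}" for t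
    using \<phi>[OF that] by simp
  with \<open>0 < \<beta>\<close> assms(1) have "continuous_on {0..1} (\<lambda>t. \<phi> t powr \<beta>)"
    by (intro continuous_on_powr' continuous_on_const) simp_all
  then show ?thesis by (rule continuous_on_power)
qed

lemma dilation_mean_bound:
  fixes g \<phi> :: "real \<Rightarrow> real"
  assumes \<phi>: "continuous_on {0..1} \<phi>" "\<And>t. t \<in> {0..1} \<Longrightarrow> \<phi> t \<in> {0..1}"
    and \<beta>: "0 < \<beta>" and g: "euler_class \<beta> n q K g" and x: "x \<in> {0..1}"
  shows "\<bar>integral {0..1} (\<lambda>t. g (x * \<phi> t))\<bar> \<le>
           K * integral {0..1} (\<lambda>t. (\<phi> t powr \<beta>) ^ n) * (x powr \<beta>) ^ n"
proof -
  have "norm (integral {0..1} (\<lambda>t. g (x * \<phi> t))) \<le>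
          integral {0..1} (\<lambda>t. K * (x powr \<beta>) ^ n * (\<phi> t powr \<beta>) ^ n)"
  proof (rule integral_norm_bound_integral)
    show "(\<lambda>t. g (x * \<phi> t)) integrable_on {0..1}"
      using dilation_integrand_continuous[OF \<phi> euler_class_continuous[OF g] x]
      by (rule integrable_continuous_real)
    show "(\<lambda>t. K * (x powr \<beta>) ^ n * (\<phi> t powr \<beta>) ^ n) integrable_on {0..1}"
      by (intro integrable_continuous_real continuous_on_mult continuous_on_const powr_power_continuous \<phi> \<beta>)
    fix t :: real assume t: "t \<in> {0..1}"
    have "x * \<phi> t \<in> {0..1}" using unit_interval_mult[OF x \<phi>(2)[OF t]] .
    from euler_class_bound[OF g this] x \<phi>(2)[OF t]
    show "norm (g (x * \<phi> t)) \<le> K * (x powr \<beta>) ^ n * (\<phi> t powr \<beta>) ^ n"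
      by (simp add: powr_mult power_mult_distrib mult_ac)
  qed
  then show ?thesis by (simp add: mult_ac)
qed

text \<open>
  The Euler operator commutes with the dilation x \<mapsto> x s for every s, and hence with
  averages over dilations.
\<close>

lemma dilation_mean_derivative:
  fixes g h \<phi> :: "real \<Rightarrow> real"
  assumes \<phi>: "continuous_on {0..1} \<phi>" "\<And>t. t \<in> {0..1} \<Longrightarrow> \<phi> t \<in> {0..1}"
    and g: "continuous_on {0..1} g" and h: "continuous_on {0..1} h" "h 0 = 0"
    and der: "\<And>x. x \<in> {0<..1} \<Longrightarrow> (g has_real_derivative h x / x) (at x within {0<..1})"
    and x: "x \<in> {0<..1}"
  shows "((\<lambda>x. integral {0..1} (\<lambda>t. g (x * \<phi> t))) has_real_derivative
            integral {0..1} (\<lambda>t. h (x * \<phi> t)) / x) (at x within {0<..1})"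
proof -
  have "((\<lambda>x. integral (cbox 0 1) (\<lambda>t. g (x * \<phi> t))) has_real_derivative
            integral (cbox 0 1) (\<lambda>t. h (x * \<phi> t) / x)) (at x within {0<..1})"
  proof (rule leibniz_rule_field_derivative[where fx = "\<lambda>x t. h (x * \<phi> t) / x"])
    fix y t :: real assume y: "y \<in> {0<..1}" and "t \<in> cbox 0 1"
    then have t: "t \<in> {0..1}" by simp
    show "((\<lambda>y. g (y * \<phi> t)) has_real_derivative h (y * \<phi> t) / y) (at y within {0<..1})"
    proof (cases "\<phi> t = 0")
      case True
      then show ?thesis using h(2) by simp
    next
      case False
      have pos: "\<phi> t > 0" "\<phi> t \<le> 1" using False \<phi>(2)[OF t] by auto
      have im: "(\<lambda>y. y * \<phi> t) ` {0<..1} \<subseteq> {0<..1}" using pos by (auto simp: mult_le_one)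
      then have "y * \<phi> t \<in> {0<..1}" using y by blast
      from has_field_derivative_subset[OF der[OF this] im]
      have "((g \<circ> (\<lambda>y. y * \<phi> t)) has_real_derivative h (y * \<phi> t) / (y * \<phi> t) * \<phi> t) (at y within {0<..1})"
        by (rule DERIV_image_chain) (auto intro!: derivative_eq_intros)
      then show ?thesis using pos by (simp add: o_def)
    qed
  next
    fix y :: real assume "y \<in> {0<..1}"
    then show "(\<lambda>t. g (y * \<phi> t)) integrable_on cbox 0 1"
      using integrable_continuous_real[OF dilation_integrand_continuous[OF \<phi> g]] by simp
  next
    show "continuous_on ({0<..1} \<times> cbox 0 1) (\<lambda>(x, t). h (x * \<phi> t) / x)"
      unfolding split_beta
    proof (intro continuous_intros)
      show "continuous_on ({0<..1} \<times> cbox 0 1) (\<lambda>p. h (fst p * \<phi> (snd p)))"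
      proof (rule continuous_on_compose2[OF h(1)])
        show "continuous_on ({0<..1} \<times> cbox 0 1) (\<lambda>p. fst p * \<phi> (snd p))"
          by (intro continuous_on_mult continuous_on_fst continuous_on_snd continuous_on_id
              continuous_on_compose2[OF \<phi>(1)]) auto
        show "(\<lambda>p. fst p * \<phi> (snd p)) ` ({0<..1} \<times> cbox 0 1) \<subseteq> {0..1}"
          using unit_interval_mult[OF _ \<phi>(2)] by force
      qed
    qed auto
  qed (use x in auto)
  then show ?thesis by simp
qed

text \<open>
  A dilation by s multiplies x^(n \<beta>) by s^(n \<beta>). The average of these factors is the norm of the
  averaging operator in weight n, and it decreases with n as soon as s < 1 almost everywhere.
\<close>

lemma euler_class_dilation_mean:
  fixes g \<phi> :: "real \<Rightarrow> real"
  assumes \<phi>: "continuous_on {0..1} \<phi>" "\<And>t. t \<in> {0..1} \<Longrightarrow> \<phi> t \<in> {0..1}" and \<beta>: "0 < \<beta>"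
  shows "euler_class \<beta> n q K g \<Longrightarrow>
    euler_class \<beta> n q (K * integral {0..1} (\<lambda>t. (\<phi> t powr \<beta>) ^ n))
      (\<lambda>x. integral {0..1} (\<lambda>t. g (x * \<phi> t)))"
proof (induction q arbitrary: g)
  case 0
  then show ?case
    using dilation_mean_continuous[OF \<phi>] dilation_mean_bound[OF \<phi> \<beta> 0] by simp
next
  case (Suc q)
  then obtain h where h: "h 0 = 0" "euler_class \<beta> n q K h"
    "\<And>x. x \<in> {0<..1} \<Longrightarrow> (g has_real_derivative h x / x) (at x within {0<..1})" by auto
  note cont = euler_class_continuous[OF Suc.prems] euler_class_continuous[OF h(2)]
  show ?case unfolding euler_class.simps
    using dilation_mean_continuous[OF \<phi> cont(1)] dilation_mean_bound[OF \<phi> \<beta> Suc.prems]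
      Suc.IH[OF h(2)] h(1) dilation_mean_derivative[OF \<phi> cont(1,2) h(1,3)]
    by (intro conjI exI[of _ "\<lambda>x. integral {0..1} (\<lambda>t. h (x * \<phi> t))"]) simp_all
qed

text \<open>
  The series of the first Euler derivatives is dominated by K on all of [0,1], but that of the
  derivatives h_n(x) / x is dominated only away from 0. Termwise differentiation is therefore done
  on intervals [x/2, 1].
\<close>

lemma euler_class_series:
  assumes \<beta>: "0 \<le> \<beta>" and K: "summable K"
  shows "(\<And>n::nat. euler_class \<beta> 0 q (K n) (d n)) \<Longrightarrow> euler_class \<beta> 0 q (\<Sum>n. K n) (\<lambda>x. \<Sum>n. d n x)"
proof (induction q arbitrary: d)
  have bnd: "\<bar>d n x\<bar> \<le> K n" if "\<And>n::nat. euler_class \<beta> 0 q (K n) (d n)" "x \<in> {0..1}" for q d n x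
    using euler_class_bound[OF that(1,2)] by simp
  have ul: "uniform_limit {0..1} (\<lambda>m x. \<Sum>n<m. d n x) (\<lambda>x. \<Sum>n. d n x) sequentially"
    if "\<And>n::nat. euler_class \<beta> 0 q (K n) (d n)" for q d
    by (rule Weierstrass_m_test[OF _ K]) (use bnd[OF that] in auto)
  have cont: "continuous_on {0..1} (\<lambda>x. \<Sum>n. d n x)"
    if "\<And>n::nat. euler_class \<beta> 0 q (K n) (d n)" for q d
    by (rule uniform_limit_theorem[OF _ ul[OF that]])
      (use euler_class_continuous[OF that] in \<open>auto intro!: continuous_intros always_eventually\<close>)
  have b: "\<bar>\<Sum>n. d n x\<bar> \<le> (\<Sum>n. K n)" 
    if "\<And>n::nat. euler_class \<beta> 0 q (K n) (d n)" "x \<in> {0..1}" for q d x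
    using norm_suminf_le[of "\<lambda>n. d n x" K] bnd[OF that] K by simp
  {
    case 0
    then show ?case using cont[OF 0] b[OF 0] by simp
  next
    case (Suc q)
    have "\<exists>h. \<forall>n. h n 0 = 0 \<and> euler_class \<beta> 0 q (K n) (h n) \<and>
      (\<forall>x\<in>{0<..1}. (d n has_real_derivative h n x / x) (at x within {0<..1}))"
    proof (intro choice allI)
      show "\<exists>h. h 0 = 0 \<and> euler_class \<beta> 0 q (K n) h \<and>
        (\<forall>x\<in>{0<..1}. (d n has_real_derivative h x / x) (at x within {0<..1}))" for n
        using Suc.prems[of n] unfolding euler_class.simps(2) by blast
    qed
    then obtain h where h: "\<And>n. h n 0 = 0" "\<And>n. euler_class \<beta> 0 q (K n) (h n)"
      "\<And>n x. x \<in> {0<..1} \<Longrightarrow> (d n has_real_derivative h n x / x) (at x within {0<..1})" by metis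
    have der: "((\<lambda>x. \<Sum>n. d n x) has_real_derivative (\<Sum>n. h n x) / x) (at x within {0<..1})"
      if x: "x \<in> {0<..1}" for x
    proof -
      define a where "a = x / 2"
      have a: "0 < a" "a < x" "x \<le> 1" using x by (auto simp: a_def)
      let ?S = "{a..1}"
      have sub: "?S \<subseteq> {0<..1}" "?S \<subseteq> {0..1}" using a by auto
      have "uniform_limit ?S (\<lambda>m y. \<Sum>n<m. h n y / y) (\<lambda>y. (\<Sum>n. h n y / y)) sequentially"
      proof (rule Weierstrass_m_test)
        show "norm (h n y / y) \<le> K n / a" if "y \<in> ?S" for n y
        proof -
          have "\<bar>h n y\<bar> \<le> K n" using bnd[OF h(2)] that sub by blast
          then have "\<bar>h n y\<bar> / y \<le> K n / a" using that a by (intro frac_le) auto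
          then show ?thesis using that a by simp
        qed
        show "summable (\<lambda>n. K n / a)" using K by (rule summable_divide)
      qed
      moreover have "(d n has_real_derivative h n y / y) (at y within ?S)" if "y \<in> ?S" for n y
        using has_field_derivative_subset[OF h(3) sub(1)] that sub by blast
      moreover have "summable (\<lambda>n. d n x)"
        by (rule summable_comparison_test'[OF K, of 0]) (use bnd[OF Suc.prems] x in auto)
      ultimately have "\<exists>g. \<forall>y\<in>?S. (\<lambda>n. d n y) sums g y \<and>
          (g has_real_derivative (\<Sum>n. h n y / y)) (at y within ?S)"
        using a by (intro has_field_derivative_series[of ?S _ _ _ x]) auto
      then obtain g where g: "\<And>y. y \<in> ?S \<Longrightarrow> (\<lambda>n. d n y) sums g y"
        "\<And>y. y \<in> ?S \<Longrightarrow> (g has_real_derivative (\<Sum>n. h n y / y)) (at y within ?S)" by blast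
      have "summable (\<lambda>n. h n x)"
        by (rule summable_comparison_test'[OF K, of 0]) (use bnd[OF h(2)] x in auto)
      then have "(\<Sum>n. h n x / x) = (\<Sum>n. h n x) / x" by (rule suminf_divide)
      moreover have "((\<lambda>y. \<Sum>n. d n y) has_real_derivative (\<Sum>n. h n x / x)) (at x within ?S)"
        by (rule has_field_derivative_transform_within[OF g(2), where d = 1])
          (use a g(1) in \<open>auto simp: sums_iff\<close>)
      moreover have "at x within ?S = at x within {0<..1}"
        by (rule at_within_nhd[of _ "{a<..}"]) (use a in auto)
      ultimately show ?thesis by simp
    qed
    show ?case unfolding euler_class.simps
      using cont[OF Suc.prems] b[OF Suc.prems] Suc.IH[OF h(2)] h(1) der
      by (intro conjI exI[of _ "\<lambda>x. \<Sum>n. h n x"]) simp_all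
  }
qed

section \<open>Fractional integrals\<close>

definition frac_node :: "real \<Rightarrow> real \<Rightarrow> real" where
  "frac_node a t = 1 - t powr (1 / a)"

text \<open>
  The Riemann-Liouville integral 1 / \<Gamma>(a) * \<integral> (x - t)^(a-1) g(t) dt over [0,x] after the
  substitution t = x (1 - s^(1/a)), which absorbs the singular kernel. What remains is an average
  of dilates of g with a continuous integrand, and x enters only through the dilation factor.
\<close>

definition frac_int :: "real \<Rightarrow> (real \<Rightarrow> real) \<Rightarrow> real \<Rightarrow> real" where
  "frac_int a g x = x powr a / Gamma (a + 1) * integral {0..1} (\<lambda>t. g (x * frac_node a t))"

lemma frac_node_continuous: "0 < a \<Longrightarrow> continuous_on {0..1} (frac_node a)"
  unfolding frac_node_def by (intro continuous_intros continuous_on_powr') auto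

lemma frac_node_unit: "0 < a \<Longrightarrow> t \<in> {0..1} \<Longrightarrow> frac_node a t \<in> {0..1}"
  unfolding frac_node_def by (auto intro: powr_unit_interval)

lemmas frac_node = frac_node_continuous frac_node_unit

lemma frac_int_0 [simp]: "frac_int a g 0 = 0"
  by (simp add: frac_int_def)

lemma frac_int_cong:
  assumes "0 < a" "\<And>x. x \<in> {0..1} \<Longrightarrow> f x = g x" "x \<in> {0..1}"
  shows "frac_int a f x = frac_int a g x"
  unfolding frac_int_def using assms
  by (intro arg_cong2[of _ _ _ _ "(*)"] refl integral_cong assms(2) unit_interval_mult frac_node_unit) auto

lemma frac_integrand_integrable:
  fixes g :: "real \<Rightarrow> real"
  assumes "0 < a" "continuous_on {0..1} g" "x \<in> {0..1}"
  shows "(\<lambda>t. g (x * frac_node a t)) integrable_on {0..1}"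
  by (intro integrable_continuous_real
      dilation_integrand_continuous[where g = g and \<phi> = "frac_node a"] frac_node assms)

lemma frac_int_add:
  assumes "0 < a" "continuous_on {0..1} f" "continuous_on {0..1} g" "x \<in> {0..1}"
  shows "frac_int a (\<lambda>x. f x + g x) x = frac_int a f x + frac_int a g x"
  unfolding frac_int_def
  using integral_add[OF frac_integrand_integrable[OF assms(1,2,4)] frac_integrand_integrable[OF assms(1,3,4)]]
  by (simp add: distrib_left)

lemma frac_int_cmult: "frac_int a (\<lambda>x. c * g x) x = c * frac_int a g x"
  by (simp add: frac_int_def mult_ac)

lemma frac_int_diff:
  assumes "0 < a" "continuous_on {0..1} f" "continuous_on {0..1} g" "x \<in> {0..1}"
  shows "frac_int a (\<lambda>x. f x - g x) x = frac_int a f x - frac_int a g x"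
  unfolding frac_int_def
  using integral_diff[OF frac_integrand_integrable[OF assms(1,2,4)] frac_integrand_integrable[OF assms(1,3,4)]]
  by (simp add: right_diff_distrib)

lemma frac_int_continuous:
  assumes "0 < a" "continuous_on {0..1} g"
  shows "continuous_on {0..1} (frac_int a g)"
  unfolding frac_int_def using assms less_imp_neq[OF Gamma_real_pos[of "a + 1"]]
  by (intro continuous_on_mult continuous_on_divide continuous_on_powr' continuous_on_const
      continuous_on_id dilation_mean_continuous[where g = g and \<phi> = "frac_node a"] frac_node) auto

lemma frac_int_bound:
  assumes a: "0 < a" and g: "continuous_on {0..1} g" "\<And>x. x \<in> {0..1} \<Longrightarrow> \<bar>g x\<bar> \<le> E"
    and x: "x \<in> {0..1}"
  shows "\<bar>frac_int a g x\<bar> \<le> E / Gamma (a + 1)"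
proof -
  have "norm (integral {0..1} (\<lambda>t. g (x * frac_node a t))) \<le> integral {0..1} (\<lambda>t::real. E)"
    by (rule integral_norm_bound_integral[OF frac_integrand_integrable[OF a g(1) x]])
      (use unit_interval_mult[OF x frac_node_unit[OF a]] g(2) in auto)
  then have *: "\<bar>integral {0..1} (\<lambda>t. g (x * frac_node a t))\<bar> \<le> E" by simp
  have "x powr a * \<bar>integral {0..1} (\<lambda>t. g (x * frac_node a t))\<bar> \<le> 1 * E"
    using powr_unit_interval[of x a] x a by (intro mult_mono *) auto
  moreover have "0 < Gamma (a + 1)" using a by (intro Gamma_real_pos) auto
  ultimately show ?thesis by (simp add: frac_int_def abs_mult divide_right_mono)
qed

text \<open>
  The norm in weight n of the average that occurs in J^\<beta>.
\<close>

definition node_moment :: "real \<Rightarrow> nat \<Rightarrow> real" where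
  "node_moment \<beta> n = integral {0..1} (\<lambda>t. (frac_node \<beta> t powr \<beta>) ^ n)"

text \<open>
  The factor x^\<beta> in front of the average supplies the additional weight.
\<close>

lemma euler_class_frac_int:
  assumes "0 < \<beta>" "\<beta> \<le> 1" "euler_class \<beta> n q K g"
  shows "euler_class \<beta> (Suc n) q (2 ^ q / Gamma (\<beta> + 1) * node_moment \<beta> n * K) (frac_int \<beta> g)"
proof -
  have G: "0 < Gamma (\<beta> + 1)" using assms by (intro Gamma_real_pos) auto
  have "euler_class \<beta> (1 + n) q (2 ^ q * (1 * (\<bar>1 / Gamma (\<beta> + 1)\<bar> * (K * node_moment \<beta> n))))
     (\<lambda>x. x powr \<beta> * (1 / Gamma (\<beta> + 1) * integral {0..1} (\<lambda>t. g (x * frac_node \<beta> t))))"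
    unfolding node_moment_def
    by (intro euler_class_mult euler_class_powr euler_class_cmult euler_class_dilation_mean[where g = g and \<phi> = "frac_node \<beta>"] frac_node assms)
  then show ?thesis unfolding frac_int_def using G by (simp add: mult_ac)
qed

lemma frac_node_power_unit: "0 < a \<Longrightarrow> 0 < \<beta> \<Longrightarrow> t \<in> {0..1} \<Longrightarrow> (frac_node a t powr \<beta>) ^ n \<in> {0..1}"
  using frac_node_unit[of a t] by (auto intro!: power_le_one powr_unit_interval)

lemma euler_class_frac_int_1:
  assumes "0 < \<beta>" "euler_class \<beta> n q K g"
  shows "euler_class \<beta> n q (2 ^ q * K) (frac_int 1 g)"
proof -
  let ?k = "integral {0..1} (\<lambda>t. (frac_node 1 t powr \<beta>) ^ n)"
  have "euler_class \<beta> (0 + n) q (2 ^ q * (1 * (K * ?k)))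
     (\<lambda>x. x * integral {0..1} (\<lambda>t. g (x * frac_node 1 t)))"
    by (intro euler_class_mult euler_class_id euler_class_dilation_mean[where g = g and \<phi> = "frac_node 1"] frac_node assms) auto
  then have "euler_class \<beta> n q (2 ^ q * (K * ?k)) (\<lambda>x. x * integral {0..1} (\<lambda>t. g (x * frac_node 1 t)))"
    by simp
  moreover have "?k \<le> integral {0..1} (\<lambda>t::real. 1)"
    by (intro integral_le integrable_continuous_real powr_power_continuous frac_node assms)
      (use frac_node_power_unit[of 1 \<beta>] assms in auto)
  then have "2 ^ q * (K * ?k) \<le> 2 ^ q * K"
    using euler_class_nonneg[OF assms(2)] by (simp add: mult_left_le)
  ultimately have "euler_class \<beta> n q (2 ^ q * K) (\<lambda>x. x * integral {0..1} (\<lambda>t. g (x * frac_node 1 t)))"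
    by (rule euler_class_mono_const)
  moreover have "frac_int 1 g x = x * integral {0..1} (\<lambda>t. g (x * frac_node 1 t))" if "x \<in> {0..1}" for x
    using that by (simp add: frac_int_def Gamma_numeral)
  ultimately show ?thesis by (rule euler_class_cong)
qed

text \<open>
  The nodes 1 - t^(1/\<beta>) are less than 1 except at t = 0, so their high powers tend to 0 almost
  everywhere.
\<close>

lemma node_moment_tendsto_0:
  assumes "0 < \<beta>" shows "node_moment \<beta> \<longlonglongrightarrow> 0"
proof -
  have "(\<lambda>n. integral {0..1} (\<lambda>t. (frac_node \<beta> t powr \<beta>) ^ n)) \<longlonglongrightarrow>
        integral {0..1::real} (\<lambda>t. if t = 0 then 1 else 0::real)"
  proof (rule dominated_convergence(2))
    show "(\<lambda>t. (frac_node \<beta> t powr \<beta>) ^ n) integrable_on {0..1}" for n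
      by (intro integrable_continuous_real powr_power_continuous frac_node assms)
    show "(\<lambda>t. 1::real) integrable_on {0..1::real}" by (intro integrable_continuous_real continuous_on_const)
    show "norm ((frac_node \<beta> t powr \<beta>) ^ n) \<le> 1" if "t \<in> {0..1}" for n t
      using frac_node_power_unit[of \<beta> \<beta> t n] that assms by simp
    show "(\<lambda>n. (frac_node \<beta> t powr \<beta>) ^ n) \<longlonglongrightarrow> (if t = 0 then 1 else 0)" if t: "t \<in> {0..1}" for t
    proof (cases "t = 0")
      case False
      then have "0 < t powr (1 / \<beta>)" using t by simp
      then have "frac_node \<beta> t < 1" by (simp add: frac_node_def)
      moreover have "0 \<le> frac_node \<beta> t" using frac_node_unit[OF assms t] by simp
      ultimately have "frac_node \<beta> t powr \<beta> < 1 powr \<beta>" using assms by (intro powr_less_mono2) auto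
      then show ?thesis using False by (auto intro!: LIMSEQ_power_zero)
    qed (simp add: frac_node_def)
  qed
  moreover have "integral {0..1::real} (\<lambda>t. if t = 0 then 1 else 0::real) = integral {0..1::real} (\<lambda>t. 0)"
    by (rule integral_spike[of "{0}"]) auto
  ultimately show ?thesis unfolding node_moment_def by simp
qed

lemma frac_int_kernel:
  assumes a: "0 < a" and g: "continuous_on {0..1} g" and x: "x \<in> {0<..1}"
  shows "(\<lambda>t. (x - t) powr (a - 1) * g t) absolutely_integrable_on {0..x}" (is ?ai)
    and "integral {0..x} (\<lambda>t. (x - t) powr (a - 1) * g t) = Gamma a * frac_int a g x" (is ?int)
proof -
  define s where "s t = (1 - t / x) powr a" for t
  define s' where "s' t = - (a / x powr a) * (x - t) powr (a - 1)" for t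
  have x0: "0 < x" "x \<le> 1" using x by auto
  have der: "(s has_field_derivative s' t) (at t within {0<..<x})" if "t \<in> {0<..<x}" for t
  proof -
    have "(s has_real_derivative - (a * (1 - t / x) powr (a - 1) / x)) (at t within {0<..<x})"
      unfolding s_def using that x0 by (auto intro!: derivative_eq_intros simp: field_simps)
    moreover have "(1 - t / x) powr (a - 1) = (x - t) powr (a - 1) / x powr (a - 1)"
      using that x0 by (simp add: powr_divide[symmetric] diff_divide_distrib)
    moreover have "x powr (a - 1) * x = x powr a" using x0 by (simp add: powr_diff)
    ultimately show ?thesis by (simp add: s'_def)
  qed
  have node: "x * frac_node a (s t) = t" if "t \<in> {0<..<x}" for t
  proof -
    have "0 < 1 - t / x" using that x0 by simp
    then have "frac_node a (s t) = t / x" using a by (simp add: frac_node_def s_def powr_powr)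
    then show ?thesis using x0 by simp
  qed
  then have inj: "inj_on s {0<..<x}" by (metis inj_onI)
  have im: "s ` {0<..<x} = {0<..<1}"
  proof (intro equalityI subsetI)
    fix y assume "y \<in> s ` {0<..<x}"
    then obtain t where t: "t \<in> {0<..<x}" "y = s t" by auto
    have *: "0 < 1 - t / x" "1 - t / x < 1" using t x0 by auto
    then have "0 < (1 - t / x) powr a" by (metis powr_gt_zero less_irrefl)
    moreover have "(1 - t / x) powr a < 1 powr a" using * a by (intro powr_less_mono2) auto
    ultimately show "y \<in> {0<..<1}" by (simp only: t(2) s_def greaterThanLessThan_iff powr_one_eq_one)
  next
    fix y :: real assume y: "y \<in> {0<..<1}"
    have "y powr (1 / a) < 1 powr (1 / a)" using y a by (intro powr_less_mono2) auto
    then have "x * frac_node a y \<in> {0<..<x}" using y x0 by (simp add: frac_node_def)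
    moreover have "s (x * frac_node a y) = y" using y x0 a by (simp add: s_def frac_node_def powr_powr)
    ultimately show "y \<in> s ` {0<..<x}" by (metis imageI)
  qed
  define F where "F t = g (x * frac_node a t)" for t
  have "continuous_on {0..1} F"
    unfolding F_def using x by (intro dilation_integrand_continuous[where g = g and \<phi> = "frac_node a"] frac_node a g) auto
  then have "F absolutely_integrable_on {0..1}" by (rule absolutely_integrable_continuous_real)
  then have "F absolutely_integrable_on {0<..<1}"
    by (rule set_integrable_subset) auto
  then have *: "(\<lambda>t. \<bar>s' t\<bar> * F (s t)) absolutely_integrable_on {0<..<x}"
    "integral {0<..<x} (\<lambda>t. \<bar>s' t\<bar> * F (s t)) = integral {0<..<1} F"
    using has_absolute_integral_change_of_variables_1'[OF _ der inj, of F "integral {0<..<1} F"]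
    unfolding im by auto
  have eq: "\<bar>s' t\<bar> * F (s t) = a / x powr a * ((x - t) powr (a - 1) * g t)" if "t \<in> {0<..<x}" for t
    using node[OF that] a by (simp add: s'_def F_def abs_mult)
  have xa: "a / x powr a \<noteq> 0" using a x0 by simp
  have "(\<lambda>t. a / x powr a * ((x - t) powr (a - 1) * g t)) absolutely_integrable_on {0<..<x}"
    using *(1) by (rule absolutely_integrable_spike[of _ _ "{}"]) (use eq in auto)
  then have "(\<lambda>t. (x powr a / a) * (a / x powr a * ((x - t) powr (a - 1) * g t))) absolutely_integrable_on {0<..<x}"
    by (rule set_integrable_mult_right)
  then have "(\<lambda>t. (x - t) powr (a - 1) * g t) absolutely_integrable_on {0<..<x}"
    using a x0 by simp
  then show ?ai by (simp add: absolutely_integrable_on_Icc_iff_Ioo)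
  have "integral {0<..<x} (\<lambda>t. a / x powr a * ((x - t) powr (a - 1) * g t)) = integral {0<..<1} F"
    unfolding *(2)[symmetric] by (rule integral_cong) (simp add: eq)
  then have "a / x powr a * integral {0<..<x} (\<lambda>t. (x - t) powr (a - 1) * g t) = integral {0<..<1} F"
    by simp
  then have "a / x powr a * integral {0..x} (\<lambda>t. (x - t) powr (a - 1) * g t) = integral {0..1} F"
    by (simp add: integral_open_interval_real)
  moreover have "Gamma (a + 1) = a * Gamma a" using a by (intro Gamma_plus1) auto
  moreover have "Gamma a \<noteq> 0" using Gamma_real_pos[OF a] by simp
  ultimately show ?int using a x0 unfolding frac_int_def F_def
    by (simp add: field_simps)
qed

lemma frac_int_1_eq:
  assumes g: "continuous_on {0..1} g" and x: "x \<in> {0..1}"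
  shows "frac_int 1 g x = integral {0..x} g"
proof (cases "x = 0")
  case False
  then have "frac_int 1 g x = integral {0..x} (\<lambda>t. (x - t) powr 0 * g t)"
    using frac_int_kernel(2)[of 1 g x] g x by simp
  also have "\<dots> = integral {0..x} g" by (rule integral_spike[of "{x}"]) auto
  finally show ?thesis .
qed simp

lemma frac_int_1_derivative:
  assumes g: "continuous_on {0..1} g" and x: "x \<in> {0..1}"
  shows "(frac_int 1 g has_real_derivative g x) (at x within {0..1})"
  by (rule has_field_derivative_transform_within[OF integral_has_real_derivative[OF g x] zero_less_one x])
    (simp add: frac_int_1_eq[OF g])

lemma frac_int_powr:
  assumes a: "0 < a" and s: "0 \<le> s" and g: "continuous_on {0..1} g"
    and gs: "\<And>t. t \<in> {0<..1} \<Longrightarrow> g t = t powr s" and x: "x \<in> {0<..1}"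
  shows "frac_int a g x = Gamma (s + 1) / Gamma (s + 1 + a) * x powr (s + a)"
proof -
  have one: "frac_int a g 1 = Gamma (s + 1) / Gamma (s + 1 + a)"
  proof -
    have "Gamma a * frac_int a g 1 = integral {0..1} (\<lambda>t. (1 - t) powr (a - 1) * g t)"
      using frac_int_kernel(2)[OF a g, of 1] by simp
    also have "\<dots> = integral {0..1} (\<lambda>t. t powr (s + 1 - 1) * (1 - t) powr (a - 1))"
      by (rule integral_spike[of "{0}"]) (auto simp: gs)
    also have "\<dots> = Beta (s + 1) a"
      by (rule integral_unique, rule has_integral_Beta_real) (use a s in auto)
    finally have "Gamma a * frac_int a g 1 = Gamma a * (Gamma (s + 1) / Gamma (s + 1 + a))"
      by (simp add: Beta_def)
    moreover have "Gamma a > 0" using a by (rule Gamma_real_pos)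
    ultimately show ?thesis by (metis mult_left_cancel less_numeral_extra(3))
  qed
  have "integral {0..1} (\<lambda>t. g (x * frac_node a t)) = integral {0..1} (\<lambda>t. x powr s * g (1 * frac_node a t))"
  proof (rule integral_spike[of "{1}"])
    fix t :: real assume t: "t \<in> {0..1} - {1}"
    have "t powr (1 / a) < 1 powr (1 / a)" using t a by (intro powr_less_mono2) auto
    then have "frac_node a t \<in> {0<..1}" using frac_node_unit[OF a, of t] t by (auto simp: frac_node_def)
    moreover from this have "x * frac_node a t \<in> {0<..1}" using x by (auto simp: mult_le_one)
    ultimately show "x powr s * g (1 * frac_node a t) = g (x * frac_node a t)"
      using x by (simp add: gs powr_mult)
  qed auto
  then have "frac_int a g x = x powr a * x powr s * frac_int a g 1"
    by (simp add: frac_int_def)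
  then show ?thesis using one by (simp add: powr_add)
qed

text \<open>
  On monomials both sides are given by the Beta integral.
\<close>

lemma frac_int_semigroup_monomial:
  assumes "0 < a" "0 < b" "x \<in> {0..1}"
  shows "frac_int a (frac_int b (\<lambda>t. t ^ n)) x = frac_int (a + b) (\<lambda>t. t ^ n) x"
proof (cases "x = 0")
  case False
  then have x: "x \<in> {0<..1}" using assms by auto
  let ?c = "Gamma (real n + 1) / Gamma (real n + 1 + b)"
  have mono: "continuous_on {0..1} (\<lambda>t::real. t ^ n)" by (intro continuous_intros)
  have Gp: "Gamma (real n + 1 + b) > 0" "Gamma (real n + 1) > 0"
    using assms by (auto intro!: Gamma_real_pos)
  have pow: "t ^ n = t powr real n" if "t \<in> {0<..1}" for t :: real
    using that by (simp add: powr_realpow)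
  have b: "frac_int b (\<lambda>t. t ^ n) t = ?c * t powr (real n + b)" if "t \<in> {0<..1}" for t
    by (rule frac_int_powr[OF assms(2) of_nat_0_le_iff mono pow that])
  have "frac_int a (frac_int b (\<lambda>t. t ^ n)) x = frac_int a (\<lambda>t. ?c * t powr (real n + b)) x"
  proof (rule frac_int_cong[OF assms(1) _ assms(3)])
    show "frac_int b (\<lambda>t. t ^ n) t = ?c * t powr (real n + b)" if "t \<in> {0..1}" for t
      using b[of t] that by (cases "t = 0") auto
  qed
  also have "\<dots> = ?c * frac_int a (\<lambda>t. t powr (real n + b)) x" by (rule frac_int_cmult)
  also have "\<dots> = ?c * (Gamma (real n + b + 1) / Gamma (real n + b + 1 + a) * x powr (real n + b + a))"
    using assms by (intro arg_cong[where f = "(*) ?c"] frac_int_powr[OF _ _ _ _ x])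
      (auto intro!: continuous_on_powr' continuous_on_id continuous_on_const)
  also have "\<dots> = Gamma (real n + 1) / Gamma (real n + 1 + (a + b)) * x powr (real n + (a + b))"
    using Gp by (simp add: add_ac)
  also have "\<dots> = frac_int (a + b) (\<lambda>t. t ^ n) x"
    by (rule frac_int_powr[OF _ of_nat_0_le_iff mono pow x, symmetric]) (use assms in auto)
  finally show ?thesis .
qed simp

lemma frac_int_sum:
  assumes "0 < a" "x \<in> {0..1}" "\<And>i. i \<in> I \<Longrightarrow> continuous_on {0..1} (g i)"
  shows "frac_int a (\<lambda>x. \<Sum>i\<in>I. g i x) x = (\<Sum>i\<in>I. frac_int a (g i) x)"
  using assms
proof (induction I rule: infinite_finite_induct)
  case (insert i I)
  then show ?case
    by (simp add: frac_int_add[of a "g i" "\<lambda>x. \<Sum>i\<in>I. g i x" x] continuous_on_sum)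
qed (simp_all add: frac_int_def)

text \<open>
  Both sides are continuous in g with respect to uniform convergence, and polynomials are dense.
  This avoids an interchange of singular integrals.
\<close>

lemma frac_int_semigroup:
  assumes ab: "0 < a" "0 < b" and g: "continuous_on {0..1} g" and x: "x \<in> {0..1}"
  shows "frac_int a (frac_int b g) x = frac_int (a + b) g x"
proof -
  \<comment> \<open>C bounds the sum of the norms of the two operators on continuous functions.\<close>
  define C where "C = 1 / Gamma (b + 1) / Gamma (a + 1) + 1 / Gamma (a + b + 1)"
  have Gp: "Gamma (b + 1) > 0" "Gamma (a + 1) > 0" "Gamma (a + b + 1) > 0"
    using ab by (auto intro!: Gamma_real_pos)
  then have C: "0 < C" unfolding C_def by (auto intro!: add_pos_pos)
  have "\<bar>frac_int a (frac_int b g) x - frac_int (a + b) g x\<bar> \<le> e" if e: "e > 0" for e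
  proof -
    have "0 < e / C" using e C by simp
    then obtain p where p: "real_polynomial_function p" "\<And>x. x \<in> {0..1} \<Longrightarrow> \<bar>g x - p x\<bar> < e / C"
      using Stone_Weierstrass_real_polynomial_function[OF compact_Icc g] by metis
    then obtain k m where pk: "p = (\<lambda>x. \<Sum>i\<le>m. k i * x ^ i)" by (auto simp: real_polynomial_function_iff_sum)
    have pc: "continuous_on {0..1} p" unfolding pk by (intro continuous_intros)
    have lin: "frac_int d p y = (\<Sum>i\<le>m. k i * frac_int d (\<lambda>t. t ^ i) y)" if "0 < d" "y \<in> {0..1}" for d y
      unfolding pk using frac_int_sum[OF that, of "{..m}" "\<lambda>i t. k i * t ^ i"]
      by (simp add: frac_int_cmult continuous_intros)
    have "frac_int a (frac_int b p) x = frac_int a (\<lambda>y. \<Sum>i\<le>m. k i * frac_int b (\<lambda>t. t ^ i) y) x"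
      using ab x lin by (intro frac_int_cong) auto
    also have "\<dots> = (\<Sum>i\<le>m. k i * frac_int a (frac_int b (\<lambda>t. t ^ i)) x)"
      using frac_int_sum[of a x "{..m}" "\<lambda>i y. k i * frac_int b (\<lambda>t. t ^ i) y"] ab x
      by (simp add: frac_int_cmult continuous_intros frac_int_continuous)
    also have "\<dots> = frac_int (a + b) p x"
      using ab x by (simp add: lin frac_int_semigroup_monomial)
    finally have eqp: "frac_int a (frac_int b p) x = frac_int (a + b) p x" .
    define r where "r t = g t - p t" for t
    have rc: "continuous_on {0..1} r" unfolding r_def using g pc by (intro continuous_intros)
    have rb: "\<bar>r t\<bar> \<le> e / C" if "t \<in> {0..1}" for t using p(2)[OF that] by (simp add: r_def)
    have "frac_int a (frac_int b r) x = frac_int a (\<lambda>t. frac_int b g t - frac_int b p t) x"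
      unfolding r_def using ab x g pc by (intro frac_int_cong frac_int_diff) auto
    also have "\<dots> = frac_int a (frac_int b g) x - frac_int a (frac_int b p) x"
      using ab x g pc by (intro frac_int_diff frac_int_continuous)
    finally have 1: "frac_int a (frac_int b r) x = frac_int a (frac_int b g) x - frac_int a (frac_int b p) x" .
    have 2: "frac_int (a + b) r x = frac_int (a + b) g x - frac_int (a + b) p x"
      unfolding r_def using ab x g pc by (intro frac_int_diff) auto
    have "\<bar>frac_int a (frac_int b r) x\<bar> \<le> e / C / Gamma (b + 1) / Gamma (a + 1)"
      using ab by (intro frac_int_bound[OF _ frac_int_continuous] frac_int_bound rc rb x)
    moreover have "\<bar>frac_int (a + b) r x\<bar> \<le> e / C / Gamma (a + b + 1)"
      using ab by (intro frac_int_bound rc rb x) auto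
    moreover have "e / C / Gamma (b + 1) / Gamma (a + 1) + e / C / Gamma (a + b + 1) = (e / C) * C"
      by (simp add: C_def distrib_left)
    moreover have "(e / C) * C = e" using C by simp
    ultimately show ?thesis using 1 2 eqp by linarith
  qed
  then have "\<bar>frac_int a (frac_int b g) x - frac_int (a + b) g x\<bar> \<le> 0"
    by (metis field_le_epsilon add_0)
  then show ?thesis by simp
qed

lemma frac_int_commute:
  assumes "0 < a" "0 < b" "continuous_on {0..1} g" "x \<in> {0..1}"
  shows "frac_int a (frac_int b g) x = frac_int b (frac_int a g) x"
  using assms by (simp add: frac_int_semigroup add.commute)

section \<open>The Volterra equation\<close>

text \<open>
  The operator T of the equation v = h + T v for the derivative v of the solution.
\<close>

definition volterra :: "real \<Rightarrow> (real \<Rightarrow> real) \<Rightarrow> (real \<Rightarrow> real) \<Rightarrow> (real \<Rightarrow> real) \<Rightarrow> real \<Rightarrow> real" where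
  "volterra \<beta> b c d = frac_int \<beta> (\<lambda>x. b x * d x + c x * frac_int 1 d x)"

lemma volterra_integrand_continuous:
  assumes "continuous_on {0..1} b" "continuous_on {0..1} c" "continuous_on {0..1} d"
  shows "continuous_on {0..1} (\<lambda>x. b x * d x + c x * frac_int 1 d x)"
  using assms by (intro continuous_on_add continuous_on_mult frac_int_continuous) auto

lemma volterra_cong:
  assumes "0 < \<beta>" "\<And>x. x \<in> {0..1} \<Longrightarrow> d x = e x" "x \<in> {0..1}"
  shows "volterra \<beta> b c d x = volterra \<beta> b c e x"
  unfolding volterra_def
  by (intro frac_int_cong arg_cong2[of _ _ _ _ "(+)"] arg_cong2[of _ _ _ _ "(*)"] assms refl) auto

lemma volterra_add:
  assumes "0 < \<beta>" "continuous_on {0..1} b" "continuous_on {0..1} c"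
    and de: "continuous_on {0..1} d" "continuous_on {0..1} e" and x: "x \<in> {0..1}"
  shows "volterra \<beta> b c (\<lambda>x. d x + e x) x = volterra \<beta> b c d x + volterra \<beta> b c e x"
proof -
  have "volterra \<beta> b c (\<lambda>x. d x + e x) x =
     frac_int \<beta> (\<lambda>x. (b x * d x + c x * frac_int 1 d x) + (b x * e x + c x * frac_int 1 e x)) x"
    unfolding volterra_def
    by (rule frac_int_cong) (use assms in \<open>simp_all add: frac_int_add algebra_simps\<close>)
  then show ?thesis
    using frac_int_add[OF assms(1) volterra_integrand_continuous volterra_integrand_continuous x] assms
    by (simp add: volterra_def)
qed

lemma volterra_cmult: "volterra \<beta> b c (\<lambda>x. a * d x) x = a * volterra \<beta> b c d x"
proof -
  have "(\<lambda>x. b x * (a * d x) + c x * frac_int 1 (\<lambda>x. a * d x) x) =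
        (\<lambda>x. a * (b x * d x + c x * frac_int 1 d x))"
    by (rule ext) (simp add: frac_int_cmult algebra_simps)
  then show ?thesis by (simp add: volterra_def frac_int_cmult)
qed

lemma euler_class_volterra:
  assumes \<beta>: "0 < \<beta>" "\<beta> \<le> 1" and b: "euler_class \<beta> 0 q B b" and c: "euler_class \<beta> 0 q C c"
  obtains M where "0 \<le> M"
    "\<And>n K d. euler_class \<beta> n q K d \<Longrightarrow>
       euler_class \<beta> (Suc n) q (M * node_moment \<beta> n * K) (volterra \<beta> b c d)"
proof
  let ?M = "2 ^ q / Gamma (\<beta> + 1) * (2 ^ q * B + 2 ^ q * (C * 2 ^ q))"
  have "0 < Gamma (\<beta> + 1)" using \<beta> by (intro Gamma_real_pos) auto
  then show "0 \<le> ?M" using b c by (auto dest!: euler_class_nonneg)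
  fix n K d assume d: "euler_class \<beta> n q K d"
  have "euler_class \<beta> (0 + n) q (2 ^ q * (B * K) + 2 ^ q * (C * (2 ^ q * K)))
      (\<lambda>x. b x * d x + c x * frac_int 1 d x)"
    by (intro euler_class_add euler_class_mult euler_class_frac_int_1 b c d \<beta>)
  from euler_class_frac_int[OF \<beta> this]
  show "euler_class \<beta> (Suc n) q (?M * node_moment \<beta> n * K) (volterra \<beta> b c d)"
    by (simp add: volterra_def algebra_simps)
qed

text \<open>
  The bounds K n for the norm of T^n h satisfy such a recurrence, because the n-th application of T
  starts from weight n.
\<close>

lemma moment_recurrence_summable:
  assumes "0 < \<beta>" and K: "\<And>n. K (Suc n) = M * node_moment \<beta> n * K n"
  shows "summable K"
proof -
  have "(\<lambda>n. M * node_moment \<beta> n) \<longlonglongrightarrow> 0"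
    using tendsto_mult_left[OF node_moment_tendsto_0[OF assms(1)], of M] by simp
  from tendstoD[OF this, of "1 / 2"]
  have "\<forall>\<^sub>F n in sequentially. \<bar>M * node_moment \<beta> n\<bar> < 1 / 2" by simp
  then obtain N where N: "\<And>n. n \<ge> N \<Longrightarrow> \<bar>M * node_moment \<beta> n\<bar> < 1 / 2"
    by (auto simp: eventually_sequentially)
  show ?thesis
  proof (rule summable_ratio_test[of "1 / 2" N])
    show "norm (K (Suc n)) \<le> 1 / 2 * norm (K n)" if "n \<ge> N" for n
      using mult_right_mono[OF less_imp_le[OF N[OF that]], of "\<bar>K n\<bar>"] by (simp add: K abs_mult)
  qed simp
qed

text \<open>
  The solution is the Neumann series of T. Its partial sums s N satisfy h + T (s N) = s (N + 1), and
  the tails have norm R N, which tends to 0.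
\<close>

lemma volterra_solution_exists:
  assumes \<beta>: "0 < \<beta>" "\<beta> \<le> 1" and b: "euler_class \<beta> 0 q B b" and c: "euler_class \<beta> 0 q C c"
    and h: "euler_class \<beta> 0 q H h"
  obtains v L where "euler_class \<beta> 0 q L v" "\<And>x. x \<in> {0..1} \<Longrightarrow> v x = h x + volterra \<beta> b c v x"
proof -
  obtain M where M: "0 \<le> M" "\<And>n K d. euler_class \<beta> n q K d \<Longrightarrow>
       euler_class \<beta> (Suc n) q (M * node_moment \<beta> n * K) (volterra \<beta> b c d)"
    using euler_class_volterra[OF \<beta> b c] by metis
  define K where "K = rec_nat H (\<lambda>n k. M * node_moment \<beta> n * k)"
  have K: "K 0 = H" "\<And>n. K (Suc n) = M * node_moment \<beta> n * K n" by (simp_all add: K_def)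
  define d where "d n = (volterra \<beta> b c ^^ n) h" for n
  have d: "d 0 = h" "\<And>n. d (Suc n) = volterra \<beta> b c (d n)" by (simp_all add: d_def)
  have "euler_class \<beta> n q (K n) (d n)" for n
    by (induction n) (use h M(2) in \<open>simp_all add: K d\<close>)
  then have dK: "euler_class \<beta> 0 q (K n) (d n)" for n
    by (rule euler_class_weight_0[OF less_imp_le[OF \<beta>(1)]])
  have sK: "summable K" by (rule moment_recurrence_summable[OF \<beta>(1) K(2)])
  have cb: "continuous_on {0..1} b" "continuous_on {0..1} c" "\<And>n. continuous_on {0..1} (d n)"
    using euler_class_continuous b c dK by blast+
  define v where "v x = (\<Sum>n. d n x)" for x
  have v: "euler_class \<beta> 0 q (\<Sum>n. K n) v"
    unfolding v_def by (rule euler_class_series[OF less_imp_le[OF \<beta>(1)] sK dK])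
  define s where "s N x = (\<Sum>n<N. d n x)" for N x
  define r where "r N x = (\<Sum>n. d (n + N) x)" for N x
  define R where "R N = (\<Sum>n. K (n + N))" for N
  have r: "euler_class \<beta> 0 q (R N) (r N)" for N
    unfolding r_def R_def
    by (rule euler_class_series[OF less_imp_le[OF \<beta>(1)]]) (use sK dK in \<open>auto simp: summable_iff_shift\<close>)
  have vsr: "v x = s N x + r N x" if "x \<in> {0..1}" for N x
  proof -
    have "summable (\<lambda>n. d n x)"
      by (rule summable_comparison_test'[OF sK, of 0]) (use euler_class_bound[OF dK that] in auto)
    from suminf_split_initial_segment[OF this, of N] show ?thesis
      by (simp add: v_def s_def r_def)
  qed
  have sc: "continuous_on {0..1} (s N)" for N
    unfolding s_def by (intro continuous_on_sum cb)
  have Ts: "h x + volterra \<beta> b c (s N) x = s (Suc N) x" if "x \<in> {0..1}" for N x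
  proof (induction N)
    case 0
    have "s 0 = (\<lambda>x. 0 * h x)" by (rule ext) (simp add: s_def)
    then show ?case using volterra_cmult[of \<beta> b c 0 h x] by (simp add: s_def d)
  next
    case (Suc N)
    have "s (Suc N) = (\<lambda>x. s N x + d N x)" by (rule ext) (simp add: s_def)
    then have "volterra \<beta> b c (s (Suc N)) x = volterra \<beta> b c (s N) x + d (Suc N) x"
      using volterra_add[OF \<beta>(1) cb(1,2) sc cb(3) that] by (simp add: d)
    moreover have "s (Suc (Suc N)) x = s (Suc N) x + d (Suc N) x" by (simp add: s_def)
    ultimately show ?case using Suc by simp
  qed
  have R0: "R \<longlonglongrightarrow> 0"
    unfolding R_def using suminf_exist_split2[OF sK] .
  have eq: "v x = h x + volterra \<beta> b c v x" if x: "x \<in> {0..1}" for x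
  proof -
    have le: "\<bar>v x - (h x + volterra \<beta> b c v x)\<bar> \<le> R (Suc N) + M * node_moment \<beta> 0 * R N" for N
    proof -
      have "volterra \<beta> b c v x = volterra \<beta> b c (\<lambda>x. s N x + r N x) x"
        by (rule volterra_cong[OF \<beta>(1) vsr x])
      also have "\<dots> = volterra \<beta> b c (s N) x + volterra \<beta> b c (r N) x"
        by (rule volterra_add[OF \<beta>(1) cb(1,2) sc euler_class_continuous[OF r] x])
      finally have "v x - (h x + volterra \<beta> b c v x) = r (Suc N) x - volterra \<beta> b c (r N) x"
        using Ts[OF x, of N] vsr[OF x, of "Suc N"] by linarith
      moreover have "\<bar>r (Suc N) x\<bar> \<le> R (Suc N)" using euler_class_bound[OF r x, of "Suc N"] by simp
      moreover have "\<bar>volterra \<beta> b c (r N) x\<bar> \<le> M * node_moment \<beta> 0 * R N"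
        using euler_class_bound[OF euler_class_weight_0[OF less_imp_le[OF \<beta>(1)] M(2)[OF r]] x, of N] by simp
      ultimately show ?thesis by linarith
    qed
    have "(\<lambda>N. R (Suc N) + M * node_moment \<beta> 0 * R N) \<longlonglongrightarrow> 0 + M * node_moment \<beta> 0 * 0"
      by (intro tendsto_intros R0 LIMSEQ_Suc)
    then have "\<bar>v x - (h x + volterra \<beta> b c v x)\<bar> \<le> 0"
      by (intro LIMSEQ_le_const) (use le in auto)
    then show ?thesis by simp
  qed
  show ?thesis using that v eq by blast
qed

text \<open>
  If d = T d then d = T^n d for all n, so d inherits the bounds of T^n d for every n.
\<close>

lemma volterra_homogeneous_unique:
  assumes \<beta>: "0 < \<beta>" "\<beta> \<le> 1" and b: "continuous_on {0..1} b" and c: "continuous_on {0..1} c"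
    and d: "continuous_on {0..1} d" "\<And>x. x \<in> {0..1} \<Longrightarrow> d x = volterra \<beta> b c d x" and x: "x \<in> {0..1}"
  shows "d x = 0"
proof -
  have ex: "\<exists>K. euler_class \<beta> 0 0 K f" if "continuous_on {0..1} f" for f
  proof -
    have "bounded (f ` {0..1})" using that by (intro compact_imp_bounded compact_continuous_image) auto
    then show ?thesis using that by (auto simp: bounded_iff)
  qed
  obtain B C D where e: "euler_class \<beta> 0 0 B b" "euler_class \<beta> 0 0 C c" "euler_class \<beta> 0 0 D d"
    using ex b c d(1) by metis
  obtain M where M: "0 \<le> M" "\<And>n K d. euler_class \<beta> n 0 K d \<Longrightarrow>
       euler_class \<beta> (Suc n) 0 (M * node_moment \<beta> n * K) (volterra \<beta> b c d)"
    using euler_class_volterra[OF \<beta> e(1,2)] by metis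
  define K where "K = rec_nat D (\<lambda>n k. M * node_moment \<beta> n * k)"
  have K: "K 0 = D" "\<And>n. K (Suc n) = M * node_moment \<beta> n * K n" by (simp_all add: K_def)
  have "euler_class \<beta> n 0 (K n) d" for n
  proof (induction n)
    case (Suc n)
    show ?case unfolding K by (rule euler_class_cong[OF M(2)[OF Suc] d(2)])
  qed (use e K in simp)
  then have "\<bar>d x\<bar> \<le> K n" for n
    using euler_class_bound[OF euler_class_weight_0[OF less_imp_le[OF \<beta>(1)]] x, of n 0 "K n" d] by simp
  moreover have "K \<longlonglongrightarrow> 0"
    by (rule summable_LIMSEQ_zero[OF moment_recurrence_summable[OF \<beta>(1) K(2)]])
  ultimately have "\<bar>d x\<bar> \<le> 0" by (intro LIMSEQ_le_const) auto
  then show ?thesis by simp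
qed

section \<open>The Caputo equation as a Volterra equation\<close>

lemma nth_deriv_on_0 [simp]: "nth_deriv_on S 0 g = g"
  by (simp add: nth_deriv_on_def)

lemma nth_deriv_on_Suc:
  "nth_deriv_on S (Suc k) g = (\<lambda>x. vector_derivative (nth_deriv_on S k g) (at x within S))"
  by (simp add: nth_deriv_on_def)

text \<open>
  Near a point x of (0,1] the half-open interval coincides with the closed interval [x/2, 1], on
  which derivatives are unique even at the endpoints.
\<close>

lemma vector_derivative_left_open:
  fixes f :: "real \<Rightarrow> real"
  assumes "(f has_real_derivative D) (at x within {0<..1})" "x \<in> {0<..1}"
  shows "vector_derivative f (at x within {0<..1}) = D"
proof -
  have eq: "at x within {0<..1} = at x within {x / 2..1}"
    by (rule at_within_nhd[of _ "{x / 2<..}"]) (use assms(2) in auto)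
  show ?thesis unfolding eq
    by (rule vector_derivative_within_closed_interval)
      (use assms eq in \<open>auto simp: has_real_derivative_iff_has_vector_derivative\<close>)
qed

lemma nth_deriv_on_unit:
  assumes "\<forall>x\<in>{0..1}. (u has_real_derivative v x) (at x within {0..1})" "x \<in> {0..1::real}"
  shows "nth_deriv_on {0..1} 1 u x = v x"
  unfolding One_nat_def nth_deriv_on_Suc nth_deriv_on_0
  by (rule vector_derivative_within_closed_interval)
    (use assms in \<open>auto simp: has_real_derivative_iff_has_vector_derivative\<close>)

lemma has_real_derivative_unit_unique:
  fixes f :: "real \<Rightarrow> real"
  assumes "(f has_real_derivative D) (at x within {0..1})" "(f has_real_derivative E) (at x within {0..1})"
    and "x \<in> {0..1}"
  shows "D = E"
  using assms vector_derivative_within_closed_interval[of 0 1 x f]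
  unfolding has_real_derivative_iff_has_vector_derivative by (metis zero_less_one)

lemma frac_int_1_of_derivative:
  assumes v: "continuous_on {0..1} v"
    and u: "\<forall>x\<in>{0..1}. (u has_real_derivative v x) (at x within {0..1})" and x: "x \<in> {0..1}"
  shows "frac_int 1 v x = u x - u 0"
proof -
  have "(v has_integral u x - u 0) {0..x}"
  proof (rule fundamental_theorem_of_calculus)
    show "(u has_vector_derivative v y) (at y within {0..x})" if "y \<in> {0..x}" for y
      using has_field_derivative_subset[OF bspec[OF u], of y "{0..x}"] that x
      by (auto simp: has_real_derivative_iff_has_vector_derivative)
  qed (use x in auto)
  then show ?thesis using frac_int_1_eq[OF v x] by (simp add: integral_unique)
qed

lemma RL_integral_eq_frac_int:
  assumes \<delta>: "1 < \<delta>" "\<delta> < 2" and w: "continuous_on {0..1} w" and y: "y \<in> {0<..1}"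
  shows "RL_kernel \<delta> w y absolutely_integrable_on {0..y}"
    and "RL_integral \<delta> w y = frac_int (2 - \<delta>) w y"
proof -
  have k: "RL_kernel \<delta> w y = (\<lambda>t. (y - t) powr (2 - \<delta> - 1) * w t)"
    by (rule ext) (simp add: RL_kernel_def)
  have "0 < Gamma (2 - \<delta>)" using \<delta> by (intro Gamma_real_pos) auto
  then have "Gamma (2 - \<delta>) \<noteq> 0" by simp
  then show "RL_kernel \<delta> w y absolutely_integrable_on {0..y}" "RL_integral \<delta> w y = frac_int (2 - \<delta>) w y"
    using frac_int_kernel[OF _ w y, of "2 - \<delta>"] \<delta> by (simp_all add: k RL_integral_def)
qed

text \<open>
  The function u minus its Taylor polynomial is J^1 (v - v 0), so its Riemann-Liouville integral of
  order 2 - \<delta> is J^1 of F = J^(2-\<delta>) (v - v 0). The first of the two derivatives in the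
  Riemann-Liouville derivative therefore always exists and equals F.
\<close>

lemma caputo_pointwise_iff:
  assumes \<delta>: "1 < \<delta>" "\<delta> < 2" and v: "continuous_on {0..1} v"
    and u: "\<forall>x\<in>{0..1}. (u has_real_derivative v x) (at x within {0..1})"
    and x: "x \<in> {0<..1}"
  shows "caputo_differentiable \<delta> u x \<and> caputo_deriv \<delta> u x = g \<longleftrightarrow>
    (frac_int (2 - \<delta>) (\<lambda>t. v t - v 0) has_real_derivative g) (at x within {0<..1})"
proof -
  define w where "w t = u t - taylor1_at_0 u t" for t
  define F where "F = frac_int (2 - \<delta>) (\<lambda>t. v t - v 0)"
  have a: "0 < 2 - \<delta>" using \<delta> by simp
  have u0: "nth_deriv_on {0..1} 1 u 0 = v 0"
    by (rule nth_deriv_on_unit[OF u]) simp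
  have vc: "continuous_on {0..1} (\<lambda>t. v t - v 0)" using v by (intro continuous_on_diff continuous_on_const)
  have wd: "\<forall>t\<in>{0..1}. (w has_real_derivative (v t - v 0)) (at t within {0..1})"
    unfolding w_def taylor1_at_0_def u0 using u by (auto intro!: derivative_eq_intros)
  have w0: "w 0 = 0" by (simp add: w_def taylor1_at_0_def)
  have wc: "continuous_on {0..1} w"
    by (rule DERIV_continuous_on[OF bspec[OF wd]])
  have w1: "w t = frac_int 1 (\<lambda>t. v t - v 0) t" if "t \<in> {0..1}" for t
    using frac_int_1_of_derivative[OF vc wd that] w0 by simp
  have Fc: "continuous_on {0..1} F" unfolding F_def by (rule frac_int_continuous[OF a vc])
  have RL: "RL_integral \<delta> w y = frac_int 1 F y" if y: "y \<in> {0<..1}" for y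
  proof -
    have y': "y \<in> {0..1}" using y by auto
    have "frac_int (2 - \<delta>) w y = frac_int (2 - \<delta>) (frac_int 1 (\<lambda>t. v t - v 0)) y"
      by (rule frac_int_cong[OF a w1 y'])
    then show ?thesis
      using RL_integral_eq_frac_int(2)[OF \<delta> wc y] frac_int_commute[OF a _ vc y', of 1] by (simp add: F_def)
  qed
  have RLd: "(RL_integral \<delta> w has_real_derivative F y) (at y within {0<..1})" if y: "y \<in> {0<..1}" for y
  proof (rule has_field_derivative_transform_within[where d = 1])
    show "(frac_int 1 F has_real_derivative F y) (at y within {0<..1})"
      using frac_int_1_derivative[OF Fc, of y] y
      by (auto intro: has_field_derivative_subset[of _ _ _ "{0..1}"])
  qed (use y RL in auto)
  have n1: "nth_deriv_on {0<..1} 1 (RL_integral \<delta> w) y = F y" if "y \<in> {0<..1}" for y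
    unfolding One_nat_def nth_deriv_on_Suc nth_deriv_on_0
    by (rule vector_derivative_left_open[OF RLd[OF that] that])
  have ev: "\<forall>\<^sub>F y in nhds x. y \<in> {0<..1} \<longrightarrow>
        RL_kernel \<delta> w y absolutely_integrable_on {0..y} \<and>
        RL_integral \<delta> w differentiable (at y within {0<..1})"
    using RL_integral_eq_frac_int(1)[OF \<delta> wc] RLd
    by (intro always_eventually) (auto simp: real_differentiable_def)
  have tr: "(nth_deriv_on {0<..1} 1 (RL_integral \<delta> w) has_real_derivative D) (at x within {0<..1}) \<longleftrightarrow>
     (F has_real_derivative D) (at x within {0<..1})" for D
    using has_field_derivative_transform_within[of _ D x "{0<..1}" 1] x n1 by (metis zero_less_one)
  have "caputo_differentiable \<delta> u x \<longleftrightarrow> (\<exists>D. (F has_real_derivative D) (at x within {0<..1}))"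
    using ev bspec[OF u, of 0] unfolding caputo_differentiable_def RL_differentiable_def w_def[symmetric]
    by (auto simp: real_differentiable_def tr[unfolded One_nat_def])
  moreover have "caputo_deriv \<delta> u x = D" if "(F has_real_derivative D) (at x within {0<..1})" for D
    unfolding caputo_deriv_def RL_deriv_def w_def[symmetric] numeral_2_eq_2 nth_deriv_on_Suc[of _ "Suc 0"]
    by (rule vector_derivative_left_open[OF _ x]) (use that tr[unfolded One_nat_def] in simp)
  ultimately show ?thesis unfolding F_def by blast
qed

text \<open>
  From left to right, F = J^(2-\<delta>) (v - v 0) has derivative g and F 0 = 0, so that F = J^1 g.
  With \<beta> = \<delta> - 1, applying J^\<beta> gives J^1 (v - v 0) = J^1 J^\<beta> g, and both sides can be differentiated.
\<close>

lemma caputo_volterra_iff: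
  assumes \<delta>: "1 < \<delta>" "\<delta> < 2" and v: "continuous_on {0..1} v"
    and u: "\<forall>x\<in>{0..1}. (u has_real_derivative v x) (at x within {0..1})"
    and g: "continuous_on {0..1} g"
  shows "(\<forall>x\<in>{0<..<1}. caputo_differentiable \<delta> u x \<and> caputo_deriv \<delta> u x = g x) \<longleftrightarrow>
    (\<forall>x\<in>{0..1}. v x = v 0 + frac_int (\<delta> - 1) g x)" (is "?L \<longleftrightarrow> ?R")
proof -
  define F where "F = frac_int (2 - \<delta>) (\<lambda>t. v t - v 0)"
  have a: "0 < 2 - \<delta>" "0 < \<delta> - 1" using \<delta> by auto
  have vc: "continuous_on {0..1} (\<lambda>t. v t - v 0)" using v by (intro continuous_on_diff continuous_on_const)
  have Fc: "continuous_on {0..1} F" unfolding F_def by (rule frac_int_continuous[OF a(1) vc])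
  have L: "?L \<longleftrightarrow> (\<forall>x\<in>{0<..<1}. (F has_real_derivative g x) (at x within {0<..1}))"
  proof -
    have *: "caputo_differentiable \<delta> u x \<and> caputo_deriv \<delta> u x = g x \<longleftrightarrow>
        (F has_real_derivative g x) (at x within {0<..1})" if "x \<in> {0<..<1}" for x
    proof -
      have x: "x \<in> {0<..1}" using that by simp
      show ?thesis unfolding F_def by (rule caputo_pointwise_iff[OF \<delta> v u x])
    qed
    then show ?thesis by blast
  qed
  show ?thesis
  proof
    assume ?R
    have "F x = frac_int 1 g x" if "x \<in> {0..1}" for x
    proof -
      have "F x = frac_int (2 - \<delta>) (frac_int (\<delta> - 1) g) x"
      proof (unfold F_def, rule frac_int_cong[OF a(1) _ that])
        show "v t - v 0 = frac_int (\<delta> - 1) g t" if "t \<in> {0..1}" for t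
          using bspec[OF \<open>?R\<close> that] by linarith
      qed
      also have "\<dots> = frac_int 1 g x" using frac_int_semigroup[OF a g that] by simp
      finally show ?thesis .
    qed
    then have "(F has_real_derivative g x) (at x within {0..1})" if "x \<in> {0..1}" for x
      by (intro has_field_derivative_transform_within[OF frac_int_1_derivative[OF g that], of 1 F])
        (use that in auto)
    then show ?L unfolding L
      by (auto intro: has_field_derivative_subset[of _ _ _ "{0..1}"])
  next
    assume ?L
    then have Fd: "(F has_real_derivative g x) (at x within {0<..1})" if "x \<in> {0<..<1}" for x
      using that L by blast
    have Fg: "F x = frac_int 1 g x" if x: "x \<in> {0..1}" for x
    proof -
      have "(g has_integral (F x - F 0)) {0..x}"
      proof (rule fundamental_theorem_of_calculus_interior)
        show "continuous_on {0..x} F" using Fc x by (auto intro: continuous_on_subset)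
        fix y assume y: "y \<in> {0<..<x}"
        have "at y within {0<..1} = at y"
          by (rule at_within_interior) (use x y in \<open>auto simp: interior_def intro!: exI[of _ "{0<..<x}"]\<close>)
        then show "(F has_vector_derivative g y) (at y)"
          using Fd[of y] x y by (simp add: has_real_derivative_iff_has_vector_derivative)
      qed (use x in auto)
      then show ?thesis using frac_int_1_eq[OF g x] by (simp add: integral_unique F_def)
    qed
    have eq: "frac_int 1 (\<lambda>t. v t - v 0) x = frac_int 1 (frac_int (\<delta> - 1) g) x" if x: "x \<in> {0..1}" for x
    proof -
      have "frac_int 1 (\<lambda>t. v t - v 0) x = frac_int (\<delta> - 1) F x"
        unfolding F_def using frac_int_semigroup[OF a(2,1) vc x] by simp
      also have "\<dots> = frac_int (\<delta> - 1) (frac_int 1 g) x" by (rule frac_int_cong[OF a(2) Fg x])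
      also have "\<dots> = frac_int 1 (frac_int (\<delta> - 1) g) x" using a g x by (intro frac_int_commute) auto
      finally show ?thesis .
    qed
    show ?R
    proof
      fix x :: real assume x: "x \<in> {0..1}"
      have "(frac_int 1 (\<lambda>t. v t - v 0) has_real_derivative (frac_int (\<delta> - 1) g x)) (at x within {0..1})"
        by (rule has_field_derivative_transform_within[OF
              frac_int_1_derivative[OF frac_int_continuous[OF a(2) g] x], of 1]) (use x eq in auto)
      from has_real_derivative_unit_unique[OF frac_int_1_derivative[OF vc x] this x]
      show "v x = v 0 + frac_int (\<delta> - 1) g x" by simp
    qed
  qed
qed

section \<open>Positivity up to a first zero\<close>

lemma frac_int_derivative:
  assumes a: "0 < a" and g: "continuous_on {0..1} g" and h: "continuous_on {0..1} h" "h 0 = 0"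
    and der: "\<And>x. x \<in> {0<..1} \<Longrightarrow> (g has_real_derivative h x / x) (at x within {0<..1})"
    and x: "x \<in> {0<..1}"
  shows "(frac_int a g has_real_derivative
      x powr (a - 1) / Gamma (a + 1) *
        integral {0..1} (\<lambda>t. a * g (x * frac_node a t) + h (x * frac_node a t))) (at x within {0<..1})"
proof -
  let ?A = "\<lambda>g x. integral {0..1} (\<lambda>t. g (x * frac_node a t))"
  have x': "x \<in> {0..1}" "0 < x" using x by auto
  have "(?A g has_real_derivative ?A h x / x) (at x within {0<..1})"
    by (rule dilation_mean_derivative) (use assms frac_node in auto)
  moreover have "((\<lambda>x. x powr a / Gamma (a + 1)) has_real_derivative (a * x powr (a - 1)) / Gamma (a + 1))
      (at x within {0<..1})"
    using x' by (intro DERIV_cdivide) (auto intro!: derivative_eq_intros)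
  ultimately have "((\<lambda>x. x powr a / Gamma (a + 1) * ?A g x) has_real_derivative
     (a * x powr (a - 1)) / Gamma (a + 1) * ?A g x + ?A h x / x * (x powr a / Gamma (a + 1))) (at x within {0<..1})"
    by (intro DERIV_mult)
  moreover have "x powr a = x powr (a - 1) * x" using x' by (simp add: powr_diff)
  moreover have "integral {0..1} (\<lambda>t. a * g (x * frac_node a t) + h (x * frac_node a t)) = a * ?A g x + ?A h x"
    using integral_add[OF integrable_on_cmult_left[OF frac_integrand_integrable[OF a g x'(1)], of a]
        frac_integrand_integrable[OF a h(1) x'(1)]] by simp
  moreover have "Gamma (a + 1) \<noteq> 0" using a by (intro less_imp_neq[symmetric] Gamma_real_pos) simp
  ultimately show ?thesis
    unfolding frac_int_def[abs_def] using x' by (elim DERIV_cong) (simp add: field_simps)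
qed

text \<open>
  With \<psi> t = v (x (1 - t^p)), \<eta> t = (\<theta> v) (x (1 - t^p)) and p = 1/a the derivative of J^a v at x is
  a positive multiple of the integral of a \<psi> + \<eta> over [0,1]. Since
  \<eta> t = - a (t^(1-p) - t) \<psi>'(t), the part \<eta> can be integrated by parts. The boundary terms are values
  of M t = (t^(1-p) - t) \<psi> t at 0 and 1 and vanish: at 1 because of the first factor, at 0 because v
  is Lipschitz near its zero x, which makes \<psi> t of order t^p. What remains is an integral of \<psi>
  against a nonpositive weight.
\<close>

lemma frac_int_derivative_at_first_zero:
  assumes a: "0 < a" "a < 1" and v: "euler_class \<beta> 0 (Suc 0) K v"
    and x: "x \<in> {0<..1}" and vx: "v x = 0" and pos: "\<And>y. y \<in> {0..x} \<Longrightarrow> 0 \<le> v y"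
    and D: "(frac_int a v has_real_derivative D) (at x within {0<..1})"
  shows "D \<le> 0"
proof -
  obtain h where h: "h 0 = 0" "continuous_on {0..1} h" "\<And>y. y \<in> {0..1} \<Longrightarrow> \<bar>h y\<bar> \<le> K"
    "\<And>y. y \<in> {0<..1} \<Longrightarrow> (v has_real_derivative h y / y) (at y within {0<..1})"
    using v by auto
  have vc: "continuous_on {0..1} v" and vK: "\<And>y. y \<in> {0..1} \<Longrightarrow> \<bar>v y\<bar> \<le> K"
    using euler_class_continuous[OF v] euler_class_bound[OF v] by auto
  have x': "x \<in> {0..1}" "0 < x" "x \<le> 1" using x by auto
  have K0: "0 \<le> K" by (rule euler_class_nonneg[OF v])
  define p where "p = 1 / a"
  have p: "1 < p" "a * p = 1" using a by (auto simp: p_def)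
  define \<psi> where "\<psi> t = v (x * frac_node a t)" for t
  define \<eta> where "\<eta> t = h (x * frac_node a t)" for t
  have node: "frac_node a t = 1 - t powr p" for t by (simp add: frac_node_def p_def)
  have unit: "x * frac_node a t \<in> {0..x}" if "t \<in> {0..1}" for t
    using frac_node_unit[OF a(1) that] x' by (auto simp: mult_left_le)
  have \<psi>0: "0 \<le> \<psi> t" if "t \<in> {0..1}" for t using pos[OF unit[OF that]] by (simp add: \<psi>_def)
  have cont: "continuous_on {0..1} \<psi>" "continuous_on {0..1} \<eta>"
    unfolding \<psi>_def \<eta>_def
    using dilation_integrand_continuous[where g = v and \<phi> = "frac_node a"]
      dilation_integrand_continuous[where g = h and \<phi> = "frac_node a"] frac_node a vc h x' by blast+
  \<comment> \<open>For t^p \<le> 1/2 the argument of v stays in [x/2, x], where the derivative of v is at most 2 K / x.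
    For larger t the trivial bound K suffices.\<close>
  have lip: "\<psi> t \<le> 2 * K * t powr p" if t: "t \<in> {0<..1}" for t
  proof (cases "t powr p \<le> 1 / 2")
    case False
    then have "K * 1 \<le> K * (2 * t powr p)" using K0 by (intro mult_left_mono) auto
    moreover have "\<psi> t \<le> K"
    proof -
      have "x * frac_node a t \<in> {0..1}" 
        using unit_interval_mult[OF x'(1) frac_node_unit[OF a(1), of t]] t by simp
      then show ?thesis using vK by (fastforce simp: \<psi>_def)
    qed
    ultimately show ?thesis by simp
  next
    case True
    define y where "y = x * frac_node a t"
    have tp: "0 < t powr p" using t by simp
    have xt: "0 < x * t powr p" "x * t powr p \<le> x / 2"
      using mult_pos_pos[OF x'(2) tp] mult_left_mono[OF True less_imp_le[OF x'(2)]] by simp_all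
    have xy: "x - y = x * t powr p" by (simp add: y_def node algebra_simps)
    then have y: "x / 2 \<le> y" "y < x" using xt by linarith+
    have "norm (v x - v y) \<le> K / (x / 2) * norm (x - y)"
    proof (rule field_differentiable_bound)
      show "convex {x / 2..x}" by simp
      fix z assume z: "z \<in> {x / 2..x}"
      show "(v has_real_derivative h z / z) (at z within {x / 2..x})"
        by (rule has_field_derivative_subset[OF h(4)]) (use z x' in auto)
      have "\<bar>h z\<bar> / z \<le> K / (x / 2)" using z x' h(3)[of z] by (intro frac_le) auto
      then show "norm (h z / z) \<le> K / (x / 2)" using z x' by simp
    qed (use y x' in auto)
    then have "\<bar>v y\<bar> \<le> K / (x / 2) * (x * t powr p)" using vx xy xt by simp
    then show ?thesis using x' by (simp add: \<psi>_def y_def[symmetric])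
  qed
  define M where "M t = (t powr (1 - p) - t) * \<psi> t" for t
  \<comment> \<open>N' = - (1 - a) (t^(-p) - 1) \<psi>: the integration by parts is carried out as the monotonicity of N,
    so that integrability of t^(-p) \<psi> is not an issue. The integrand \<psi> + \<eta> dominates a \<psi> + \<eta>.\<close>
  define N where "N t = integral {0..t} (\<lambda>s. \<psi> s + \<eta> s) + a * M t" for t
  have M_le: "\<bar>M t\<bar> \<le> 2 * K * t" if t: "t \<in> {0<..1}" for t
  proof -
    have "t powr p \<le> 1" using t p by (intro powr_unit_interval) auto
    moreover have "t powr (1 - p) * t powr p = t" using t by (simp add: powr_add[symmetric])
    ultimately have "t \<le> t powr (1 - p)"
      using mult_left_mono[of "t powr p" 1 "t powr (1 - p)"] by simp
    then have "\<bar>M t\<bar> \<le> t powr (1 - p) * (2 * K * t powr p)"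
      unfolding M_def abs_mult using lip[OF t] \<psi>0[of t] t by (intro mult_mono) auto
    also have "\<dots> = 2 * K * t" using \<open>t powr (1 - p) * t powr p = t\<close> by (simp add: mult_ac)
    finally show ?thesis .
  qed
  have Mc: "continuous_on {0..1} M"
  proof (rule continuous_on_eq_continuous_within[THEN iffD2], rule ballI)
    fix t :: real assume t: "t \<in> {0..1}"
    show "continuous (at t within {0..1}) M"
    proof (cases "t = 0")
      case True
      have "((\<lambda>t. 2 * K * t) \<longlongrightarrow> 2 * K * 0) (at 0 within {0..1})" by (intro tendsto_intros)
      then have "(M \<longlongrightarrow> 0) (at 0 within {0..1})"
        by (intro Lim_null_comparison[of M "\<lambda>t. 2 * K * t"])
          (use M_le in \<open>auto simp: eventually_at intro!: exI[of _ 1]\<close>)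
      then show ?thesis using True p by (simp add: continuous_within M_def)
    next
      case False
      have "continuous (at t within {0..1}) \<psi>"
        using cont(1) t by (simp add: continuous_on_eq_continuous_within)
      moreover have "continuous (at t within {0..1}) (\<lambda>t. t powr (1 - p) - t)"
        using False by (intro continuous_intros) auto
      ultimately show ?thesis unfolding M_def by (intro continuous_mult)
    qed
  qed
  have sc: "continuous_on {0..1} (\<lambda>s. \<psi> s + \<eta> s)" using cont by (intro continuous_on_add)
  have "N 1 \<le> N 0"
  proof (rule DERIV_nonpos_imp_decreasing_open[of 0 1 N])
    show "continuous_on {0..1} N"
      unfolding N_def
      by (intro continuous_on_add continuous_on_mult continuous_on_const Mc
          indefinite_integral_continuous_1 integrable_continuous_real sc)
    fix t :: real assume t: "0 < t" "t < 1"
    have tu: "t \<in> {0..1}" using t by simp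
    have at: "at t within {0..1} = at t"
      by (rule at_within_open_subset[of _ "{0<..<1}"]) (use t in auto)
    have tp: "0 < t powr p" "t powr p < 1" using t p powr_less_mono2[of p t 1] by auto
    define z where "z = x * frac_node a t"
    have z: "0 < z" "z < 1"
    proof -
      show "0 < z" using x' tp by (simp add: z_def node)
      have "x * (1 - t powr p) < x * 1" using x'(2) tp by (intro mult_strict_left_mono) auto
      also have "\<dots> \<le> 1" using x' by simp
      finally show "z < 1" by (simp only: z_def node)
    qed
    have "at z within {0<..1} = at z"
      by (rule at_within_open_subset[of _ "{0<..<1}"]) (use z in auto)
    then have "(v has_real_derivative h z / z) (at z)" using h(4)[of z] z by simp
    moreover have "((\<lambda>t. x * frac_node a t) has_real_derivative - (x * (p * t powr (p - 1)))) (at t)"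
      unfolding node using t by (auto intro!: derivative_eq_intros)
    ultimately have d\<psi>: "(\<psi> has_real_derivative h z / z * - (x * (p * t powr (p - 1)))) (at t)"
      unfolding \<psi>_def z_def by (rule DERIV_chain2)
    have "(M has_real_derivative ((1 - p) * t powr (1 - p - 1) - 1) * \<psi> t +
        h z / z * - (x * (p * t powr (p - 1))) * (t powr (1 - p) - t)) (at t)"
      unfolding M_def by (rule DERIV_mult[OF _ d\<psi>]) (use t in \<open>auto intro!: derivative_eq_intros\<close>)
    moreover have "h z / z * - (x * (p * t powr (p - 1))) * (t powr (1 - p) - t) = - p * \<eta> t"
    proof -
      have "t powr (1 - p) - t = t powr (1 - p) * frac_node a t"
        using t by (simp add: node right_diff_distrib powr_add[symmetric])
      moreover have "t powr (p - 1) * t powr (1 - p) = 1" using t by (simp add: powr_add[symmetric])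
      ultimately have "x * (p * t powr (p - 1)) * (t powr (1 - p) - t) = p * z"
        by (simp add: z_def mult_ac)
      then have "h z / z * - (x * (p * t powr (p - 1))) * (t powr (1 - p) - t) = - (h z / z) * (p * z)"
        by (metis mult_minus_left mult_minus_right mult.assoc)
      then show ?thesis using z by (simp add: \<eta>_def z_def[symmetric])
    qed
    moreover have "((\<lambda>t. integral {0..t} (\<lambda>s. \<psi> s + \<eta> s)) has_real_derivative \<psi> t + \<eta> t) (at t)"
      using integral_has_real_derivative[OF sc tu] by (simp add: at)
    ultimately have "(N has_real_derivative (\<psi> t + \<eta> t) +
        a * (((1 - p) * t powr (1 - p - 1) - 1) * \<psi> t + - p * \<eta> t)) (at t)"
      unfolding N_def by (intro DERIV_add DERIV_cmult) simp_all
    moreover have "(\<psi> t + \<eta> t) + a * (((1 - p) * t powr (1 - p - 1) - 1) * \<psi> t + - p * \<eta> t) =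
        (1 - a * p) * \<eta> t + \<psi> t * ((1 - a) + (a - a * p) * t powr (- p))"
      by (simp add: algebra_simps)
    then have "(\<psi> t + \<eta> t) + a * (((1 - p) * t powr (1 - p - 1) - 1) * \<psi> t + - p * \<eta> t) =
        - ((1 - a) * (\<psi> t * (t powr (- p) - 1)))"
      using p(2) by (simp add: algebra_simps)
    moreover have "1 \<le> t powr (- p)" using tp by (simp add: powr_minus one_le_inverse)
    ultimately show "\<exists>y. (N has_real_derivative y) (at t) \<and> y \<le> 0"
      using \<psi>0[OF tu] a by (auto intro!: exI mult_nonneg_nonneg)
  qed simp
  then have le: "integral {0..1} (\<lambda>t. \<psi> t + \<eta> t) \<le> 0" by (simp add: N_def M_def)
  have "integral {0..1} (\<lambda>t. a * \<psi> t + \<eta> t) \<le> integral {0..1} (\<lambda>t. \<psi> t + \<eta> t)"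
  proof (rule integral_le)
    show "a * \<psi> t + \<eta> t \<le> \<psi> t + \<eta> t" if "t \<in> {0..1}" for t
      using mult_right_mono[of a 1 "\<psi> t"] \<psi>0[OF that] a by simp
  qed (intro integrable_continuous_real continuous_on_add continuous_on_mult continuous_on_const cont)+
  with le have "integral {0..1} (\<lambda>t. a * \<psi> t + \<eta> t) \<le> 0" by linarith
  moreover have "D = x powr (a - 1) / Gamma (a + 1) * integral {0..1} (\<lambda>t. a * \<psi> t + \<eta> t)"
    using vector_derivative_left_open[OF D x]
      vector_derivative_left_open[OF frac_int_derivative[OF a(1) vc h(2,1,4) x] x]
    by (simp add: \<psi>_def \<eta>_def)
  moreover have "0 < Gamma (a + 1)" using a by (intro Gamma_real_pos) auto
  ultimately show ?thesis by (auto intro!: divide_nonpos_pos mult_nonneg_nonpos)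
qed

text \<open>
  At the first zero z of v the derivative of J^(1-\<beta>) v is, by the integral equation, the derivative
  of v0 z^(1-\<beta>) / \<Gamma>(2-\<beta>), which is positive, plus g z. The hypothesis on the sign of g concerns
  only zeros up to which v is nonnegative, since g depends on v.
\<close>

lemma volterra_solution_positive:
  assumes \<beta>: "0 < \<beta>" "\<beta> < 1" and v: "euler_class \<beta> 0 (Suc 0) K v" and g: "continuous_on {0..1} g"
    and eq: "\<And>x. x \<in> {0..1} \<Longrightarrow> v x = v0 + frac_int \<beta> g x" and v0: "0 < v0"
    and sign: "\<And>x. x \<in> {0..1} \<Longrightarrow> v x = 0 \<Longrightarrow> (\<And>y. y \<in> {0..x} \<Longrightarrow> 0 \<le> v y) \<Longrightarrow> 0 \<le> g x"
    and x: "x \<in> {0..1}"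
  shows "0 < v x"
proof (rule ccontr)
  assume neg: "\<not> 0 < v x"
  have vc: "continuous_on {0..1} v" by (rule euler_class_continuous[OF v])
  have vv0: "v 0 = v0" using eq[of 0] by simp
  have zero: "\<exists>z. 0 \<le> z \<and> z \<le> y \<and> v z = 0" if "y \<in> {0..1}" "v y \<le> 0" for y
    using that vv0 v0 continuous_on_subset[OF vc, of "{0..y}"] by (intro IVT2') auto
  define Z where "Z = {0..1} \<inter> v -` {0}"
  have "closed Z" unfolding Z_def by (rule continuous_closed_preimage[OF vc]) auto
  moreover have "bounded Z" by (rule bounded_subset[of "{0..1}"]) (auto simp: Z_def)
  ultimately have "compact Z" by (simp add: compact_eq_bounded_closed)
  moreover have "Z \<noteq> {}" using zero[OF x] neg x by (fastforce simp: Z_def)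
  ultimately obtain z where z: "z \<in> Z" "\<And>y. y \<in> Z \<Longrightarrow> z \<le> y"
    using compact_attains_inf by metis
  have zu: "z \<in> {0..1}" "v z = 0" using z(1) by (auto simp: Z_def)
  then have "z \<noteq> 0" using vv0 v0 by auto
  then have z0: "z \<in> {0<..1}" using zu by auto
  have before: "0 \<le> v y" if y: "y \<in> {0..z}" for y
  proof (rule ccontr)
    assume n: "\<not> 0 \<le> v y"
    then obtain w where w: "0 \<le> w" "w \<le> y" "v w = 0" using zero[of y] y zu by auto
    then have "z \<le> w" using z(2)[of w] y zu by (auto simp: Z_def)
    then have "y = z" using w y by auto
    then show False using n zu by simp
  qed
  have gz: "0 \<le> g z" by (rule sign[OF zu before])
  define a where "a = 1 - \<beta>"
  have a: "0 < a" "a < 1" using \<beta> by (auto simp: a_def)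
  have Fc: "continuous_on {0..1} (frac_int \<beta> g)" by (rule frac_int_continuous[OF \<beta>(1) g])
  have G: "frac_int a v y = v0 * (y powr a / Gamma (a + 1)) + frac_int 1 g y" if "y \<in> {0..1}" for y
  proof -
    have "frac_int a v y = frac_int a (\<lambda>t. v0 + frac_int \<beta> g t) y"
      by (rule frac_int_cong[OF a(1) eq that])
    also have "\<dots> = frac_int a (\<lambda>t. v0) y + frac_int a (frac_int \<beta> g) y"
      by (rule frac_int_add[OF a(1) continuous_on_const Fc that])
    also have "frac_int a (frac_int \<beta> g) y = frac_int 1 g y"
      using frac_int_semigroup[OF a(1) \<beta>(1) g that] by (simp add: a_def)
    finally show ?thesis by (simp add: frac_int_def)
  qed
  have "((\<lambda>y. v0 * (y powr a / Gamma (a + 1)) + frac_int 1 g y) has_real_derivative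
      v0 * (a * z powr (a - 1) / Gamma (a + 1)) + g z) (at z within {0<..1})"
  proof (intro DERIV_add DERIV_cmult DERIV_cdivide)
    show "((\<lambda>y. y powr a) has_real_derivative a * z powr (a - 1)) (at z within {0<..1})"
      using z0 by (auto intro!: derivative_eq_intros)
    show "(frac_int 1 g has_real_derivative g z) (at z within {0<..1})"
      by (rule has_field_derivative_subset[OF frac_int_1_derivative[OF g zu(1)]]) auto
  qed
  then have "(frac_int a v has_real_derivative
      v0 * (a * z powr (a - 1) / Gamma (a + 1)) + g z) (at z within {0<..1})"
    by (rule has_field_derivative_transform_within[of _ _ _ _ 1]) (use z0 G in auto)
  from frac_int_derivative_at_first_zero[OF a v z0 zu(2) before this]
  have "v0 * (a * z powr (a - 1) / Gamma (a + 1)) + g z \<le> 0" by simp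
  moreover have "0 < Gamma (a + 1)" using a by (intro Gamma_real_pos) auto
  then have "0 < v0 * (a * z powr (a - 1) / Gamma (a + 1))" using v0 a z0 by simp
  ultimately show False using gz by linarith
qed

section \<open>Weighted spaces and regularity\<close>

text \<open>
  The logarithmic case of the weighted bounds is absorbed into the power x^(\<beta>-1).
\<close>

lemma one_plus_abs_ln_le_powr:
  assumes "0 < \<beta>" "\<beta> < 1" "x \<in> {0<..1::real}"
  shows "1 + \<bar>ln x\<bar> \<le> (1 + 1 / (1 - \<beta>)) * x powr (\<beta> - 1)"
proof -
  have "1 \<le> 1 / x" using assms by simp
  then have "ln (1 / x) \<le> (1 / x) powr (1 - \<beta>) / (1 - \<beta>)"
    using assms by (intro ln_powr_bound) auto
  moreover have p: "(1 / x) powr (1 - \<beta>) = x powr (\<beta> - 1)"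
    using assms powr_minus[of x "1 - \<beta>"] by (simp add: powr_divide inverse_eq_divide)
  moreover have "1 powr (1 - \<beta>) \<le> (1 / x) powr (1 - \<beta>)"
    using assms \<open>1 \<le> 1 / x\<close> by (intro powr_mono2) auto
  moreover have "\<bar>ln x\<bar> = ln (1 / x)" using assms by (simp add: ln_div)
  ultimately show ?thesis by (simp add: distrib_right)
qed

lemma Cq_weighted_derivative_bound:
  assumes \<beta>: "0 < \<beta>" "\<beta> < 1" and \<mu>: "\<mu> \<le> 1 - \<beta>" and y: "y \<in> Cq_weighted q \<mu>"
  obtains C where "0 \<le> C" "\<And>i x. i \<in> {1..q} \<Longrightarrow> x \<in> {0<..1} \<Longrightarrow>
    \<bar>x ^ i * nth_deriv_on {0<..1} i y x\<bar> \<le> C * x powr \<beta>"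
proof -
  obtain C where C: "\<And>x i. x \<in> {0<..1} \<Longrightarrow> i \<in> {1..q} \<Longrightarrow> \<bar>nth_deriv_on {0<..1} i y x\<bar> \<le>
      (if real i < 1 - \<mu> then C else if real i = 1 - \<mu> then C * (1 + \<bar>ln x\<bar>)
       else C * x powr (1 - \<mu> - real i))"
    using y unfolding Cq_weighted_def by blast
  define A where "A = 1 + 1 / (1 - \<beta>)"
  have A: "1 \<le> A" using \<beta> by (simp add: A_def)
  have "\<bar>x ^ i * nth_deriv_on {0<..1} i y x\<bar> \<le> (\<bar>C\<bar> * A) * x powr \<beta>"
    if i: "i \<in> {1..q}" and x: "x \<in> {0<..1}" for i x
  proof -
    have xi: "x ^ i = x powr real i" using x by (simp add: powr_realpow)
    have le: "x powr s \<le> x powr r" if "r \<le> s" for r s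
      using x that powr_mono_both[of r s x x] by (auto intro: powr_mono')
    have "\<bar>nth_deriv_on {0<..1} i y x\<bar> \<le> \<bar>C\<bar> * (A * x powr (\<beta> - real i))"
    proof (cases "real i < 1 - \<mu>")
      case True
      have "C * 1 \<le> \<bar>C\<bar> * (A * x powr (\<beta> - real i))"
        using A le[of "\<beta> - real i" 0] i \<beta> x by (intro mult_mono mult_ge1_I) (auto intro!: mult_nonneg_nonneg)
      then show ?thesis using C[OF x i] True by simp
    next
      case False
      show ?thesis
      proof (cases "real i = 1 - \<mu>")
        case True
        have "1 + \<bar>ln x\<bar> \<le> A * x powr (\<beta> - real i)"
          using one_plus_abs_ln_le_powr[OF \<beta> x] le[of "\<beta> - real i" "\<beta> - 1"] i A
            mult_left_mono[of "x powr (\<beta> - 1)" "x powr (\<beta> - real i)" A] by (simp add: A_def)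
        then have "C * (1 + \<bar>ln x\<bar>) \<le> \<bar>C\<bar> * (A * x powr (\<beta> - real i))"
          by (intro mult_mono) auto
        then show ?thesis using C[OF x i] True by simp
      next
        case neq: False
        have "1 * x powr (1 - \<mu> - real i) \<le> A * x powr (\<beta> - real i)"
          using A \<mu> by (intro mult_mono le) auto
        then have "C * x powr (1 - \<mu> - real i) \<le> \<bar>C\<bar> * (A * x powr (\<beta> - real i))"
          by (intro mult_mono) auto
        then show ?thesis using C[OF x i] False neq by simp
      qed
    qed
    then have "x ^ i * \<bar>nth_deriv_on {0<..1} i y x\<bar> \<le> x ^ i * (\<bar>C\<bar> * (A * x powr (\<beta> - real i)))"
      using x by (intro mult_left_mono) auto
    also have "\<dots> = (\<bar>C\<bar> * A) * x powr \<beta>" using x by (simp add: xi powr_diff)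
    finally show ?thesis using x by (simp add: abs_mult)
  qed
  then show ?thesis using that[of "\<bar>C\<bar> * A"] A by auto
qed

lemma nth_deriv_on_has_derivative:
  assumes "y \<in> Ck q {0<..1}" "j < q" "x \<in> {0<..1}"
  shows "(nth_deriv_on {0<..1} j y has_real_derivative nth_deriv_on {0<..1} (Suc j) y x) (at x within {0<..1})"
proof -
  have "nth_deriv_on {0<..1} j y differentiable (at x within {0<..1})"
    using assms by (auto simp: Ck_def differentiable_on_def)
  then obtain D where D: "(nth_deriv_on {0<..1} j y has_real_derivative D) (at x within {0<..1})"
    by (auto simp: real_differentiable_def)
  then show ?thesis
    using vector_derivative_left_open[OF D assms(3)] by (simp add: nth_deriv_on_Suc)
qed

text \<open>
  The functions w j x = x^j y^(j)(x) satisfy \<theta> (w j) = j w j + w (j + 1), are continuous on [0,1] and,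
  for j > 0, vanish at 0. Induction on m puts w j into the class of order m whenever j + m \<le> q; the
  case j = 0, m = q is the claim.
\<close>

lemma Cq_weighted_imp_euler_class:
  assumes \<beta>: "0 < \<beta>" "\<beta> < 1" and \<mu>: "\<mu> \<le> 1 - \<beta>" and y: "y \<in> Cq_weighted q \<mu>"
  obtains K where "euler_class \<beta> 0 q K y"
proof -
  let ?S = "{0<..1::real}"
  define w where "w j x = x ^ j * nth_deriv_on ?S j y x" for j x
  have yc: "continuous_on {0..1} y" "y \<in> Ck q ?S" using y by (auto simp: Cq_weighted_def)
  obtain C where C: "0 \<le> C" "\<And>i x. i \<in> {1..q} \<Longrightarrow> x \<in> ?S \<Longrightarrow> \<bar>w i x\<bar> \<le> C * x powr \<beta>"
    using Cq_weighted_derivative_bound[OF assms] unfolding w_def by metis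
  have w0: "w 0 = y" by (rule ext) (simp add: w_def)
  have w0': "w j 0 = 0" if "0 < j" for j using that by (simp add: w_def)
  have wc: "continuous_on {0..1} (w j)" if j: "j \<le> q" for j
  proof (cases "j = 0")
    case False
    show ?thesis unfolding continuous_on_eq_continuous_within
    proof
      fix x :: real assume x: "x \<in> {0..1}"
      show "continuous (at x within {0..1}) (w j)"
      proof (cases "x = 0")
        case True
        have "continuous_on {0..1} (\<lambda>t::real. C * t powr \<beta>)"
          using \<beta> by (intro continuous_on_mult continuous_on_powr' continuous_on_id continuous_on_const) auto
        then have "((\<lambda>t. C * t powr \<beta>) \<longlongrightarrow> C * 0 powr \<beta>) (at 0 within {0..1})"
          unfolding continuous_on_def by (rule bspec) simp
        then have "((\<lambda>t. C * t powr \<beta>) \<longlongrightarrow> 0) (at 0 within {0..1})" by simp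
        then have "(w j \<longlongrightarrow> 0) (at 0 within {0..1})"
          by (rule Lim_null_comparison[rotated])
            (use C(2)[of j] j False in \<open>auto simp: eventually_at intro!: exI[of _ 1]\<close>)
        then show ?thesis using True False w0' by (simp add: continuous_within)
      next
        case x0: False
        have "continuous_on ?S (nth_deriv_on ?S j y)" using yc j by (auto simp: Ck_def)
        then have "continuous_on ?S (w j)" unfolding w_def by (intro continuous_intros)
        then have "continuous (at x within ?S) (w j)"
          using x x0 by (auto simp: continuous_on_eq_continuous_within)
        moreover have "at x within ?S = at x within {0..1}"
          by (rule at_within_nhd[of _ "{0<..}"]) (use x x0 in auto)
        ultimately show ?thesis by simp
      qed
    qed
  qed (use w0 yc in simp)
  have "\<exists>K. euler_class \<beta> 0 m K (w j)" if "j + m \<le> q" for j m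
    using that
  proof (induction m arbitrary: j)
    case 0
    have "bounded (w j ` {0..1})"
      using wc[of j] 0 by (intro compact_imp_bounded compact_continuous_image) auto
    then show ?case using wc[of j] 0 by (auto simp: bounded_iff)
  next
    case (Suc m)
    obtain K where K: "euler_class \<beta> 0 m K (w j)" using Suc.IH[of j] Suc.prems by auto
    obtain L where L: "euler_class \<beta> 0 m L (w (Suc j))" using Suc.IH[of "Suc j"] Suc.prems by auto
    define h where "h x = real j * w j x + w (Suc j) x" for x
    have h: "euler_class \<beta> 0 m (\<bar>real j\<bar> * K + L) h"
      unfolding h_def by (intro euler_class_add euler_class_cmult K L)
    have h0: "h 0 = 0" by (cases "j = 0") (simp_all add: h_def w0')
    have der: "(w j has_real_derivative h x / x) (at x within ?S)" if x: "x \<in> ?S" for x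
    proof -
      have "(w j has_real_derivative real j * x ^ (j - 1) * nth_deriv_on ?S j y x +
          nth_deriv_on ?S (Suc j) y x * x ^ j) (at x within ?S)"
        unfolding w_def
        by (rule DERIV_mult[OF _ nth_deriv_on_has_derivative[OF yc(2) _ x]])
          (use Suc.prems in \<open>auto intro!: derivative_eq_intros\<close>)
      moreover have "real j * x ^ (j - 1) * nth_deriv_on ?S j y x +
          nth_deriv_on ?S (Suc j) y x * x ^ j = h x / x"
        using x by (cases j) (simp_all add: h_def w_def field_simps)
      ultimately show ?thesis by simp
    qed
    let ?M = "max K (\<bar>real j\<bar> * K + L)"
    have "euler_class \<beta> 0 m ?M h" "euler_class \<beta> 0 m ?M (w j)"
      using euler_class_mono_const[OF h] euler_class_mono_const[OF K] by auto
    then have "euler_class \<beta> 0 (Suc m) ?M (w j)"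
      unfolding euler_class.simps using h0 der euler_class_continuous euler_class_bound by blast
    then show ?case by blast
  qed
  from this[of 0 q] show ?thesis using that w0 by auto
qed

text \<open>
  The derivative of w / x^i is (\<theta> w - i w) / x^(i+1).
\<close>

lemma euler_quotient_derivative:
  assumes w: "euler_class \<beta> n (Suc m) K w" and D: "\<And>x. x \<in> {0<..1} \<Longrightarrow> D x = w x / x ^ i"
  obtains L h where "euler_class \<beta> n m L h"
    "\<And>x. x \<in> {0<..1} \<Longrightarrow> (D has_real_derivative h x / x ^ Suc i) (at x within {0<..1})"
proof -
  obtain k where k: "euler_class \<beta> n m K k"
    "\<And>x. x \<in> {0<..1} \<Longrightarrow> (w has_real_derivative k x / x) (at x within {0<..1})"
    using w by auto
  have h: "euler_class \<beta> n m (K + \<bar>- real i\<bar> * K) (\<lambda>x. k x + - real i * w x)"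
    by (intro euler_class_add euler_class_cmult k(1) euler_class_SucD[OF w])
  show ?thesis
  proof (rule that[OF h])
    fix x :: real assume x: "x \<in> {0<..1}"
    have "((\<lambda>x. w x / x ^ i) has_real_derivative
        (k x / x * x ^ i - w x * (real i * x ^ (i - 1))) / (x ^ i * x ^ i)) (at x within {0<..1})"
      by (rule DERIV_divide[OF k(2)[OF x]]) (use x in \<open>auto intro!: derivative_eq_intros\<close>)
    moreover have "(k x / x * x ^ i - w x * (real i * x ^ (i - 1))) / (x ^ i * x ^ i) =
        (k x + - real i * w x) / x ^ Suc i"
      using x by (cases i) (simp_all add: field_simps)
    ultimately have "((\<lambda>x. w x / x ^ i) has_real_derivative (k x + - real i * w x) / x ^ Suc i)
        (at x within {0<..1})" by simp
    then show "(D has_real_derivative (k x + - real i * w x) / x ^ Suc i) (at x within {0<..1})"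
      by (rule has_field_derivative_transform_within[where d = 1]) (use x D in auto)
  qed
qed

lemma euler_quotient_nth_deriv:
  assumes w: "euler_class \<beta> n m K w"
    and D: "\<And>x. x \<in> {0<..1} \<Longrightarrow> nth_deriv_on {0<..1} k u x = w x / x ^ i" and j: "j \<le> m"
  shows "\<exists>L h. euler_class \<beta> n (m - j) L h \<and>
    (\<forall>x\<in>{0<..1}. nth_deriv_on {0<..1} (k + j) u x = h x / x ^ (i + j))"
  using j
proof (induction j)
  case (Suc j)
  then obtain L h where h: "euler_class \<beta> n (Suc (m - Suc j)) L h"
    "\<And>x. x \<in> {0<..1} \<Longrightarrow> nth_deriv_on {0<..1} (k + j) u x = h x / x ^ (i + j)"
    by (auto simp: Suc_diff_Suc)
  obtain L' h' where h': "euler_class \<beta> n (m - Suc j) L' h'"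
    "\<And>x. x \<in> {0<..1} \<Longrightarrow> (nth_deriv_on {0<..1} (k + j) u has_real_derivative h' x / x ^ Suc (i + j))
       (at x within {0<..1})"
    using euler_quotient_derivative[OF h] by metis
  have "nth_deriv_on {0<..1} (k + Suc j) u x = h' x / x ^ (i + Suc j)" if "x \<in> {0<..1}" for x
    using vector_derivative_left_open[OF h'(2)[OF that] that] by (simp add: nth_deriv_on_Suc)
  then show ?case using h'(1) by blast
qed (use w D in auto)

text \<open>
  The class of v yields existence and continuity of the derivatives. The bounds come from
  u'' = \<theta> (v - v0) / x: here the numerator has weight 1, i.e. is of order x^(\<delta>-1), and each further
  derivative of the quotient costs one power of x and one order of the class.
\<close>

lemma euler_class_primitive_regular:
  assumes \<delta>: "1 < \<delta>" and v: "euler_class (\<delta> - 1) 0 q K v"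
    and dv: "euler_class (\<delta> - 1) 1 q L (\<lambda>x. v x - v0)" and q: "0 < q"
    and uc: "continuous_on {0<..1} u"
    and u: "\<And>x. x \<in> {0<..1} \<Longrightarrow> (u has_real_derivative v x) (at x within {0<..1})"
  shows "u \<in> Ck (q + 1) {0<..1}"
    and "\<exists>C. \<forall>x\<in>{0<..1}. \<forall>i\<in>{2..q + 1}. \<bar>nth_deriv_on {0<..1} i u x\<bar> \<le> C * x powr (\<delta> - real i)"
proof -
  let ?S = "{0<..1::real}" and ?b = "\<delta> - 1"
  have n1: "nth_deriv_on ?S (Suc 0) u x = v x" if "x \<in> ?S" for x
    using vector_derivative_left_open[OF u[OF that] that] by (simp add: nth_deriv_on_Suc)
  have pre: "\<exists>L h. euler_class ?b 0 (q - j) L h \<and>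
      (\<forall>x\<in>?S. nth_deriv_on ?S (Suc j) u x = h x / x ^ j)" if "j \<le> q" for j
    using euler_quotient_nth_deriv[OF v, of "Suc 0" u 0, OF _ that] n1 by simp
  have cont: "continuous_on ?S (nth_deriv_on ?S i u)" if "i \<le> q + 1" for i
  proof (cases i)
    case (Suc j)
    then have "j \<le> q" using that by simp
    from pre[OF this] obtain L h where h: "euler_class ?b 0 (q - j) L h"
      "\<forall>x\<in>?S. nth_deriv_on ?S (Suc j) u x = h x / x ^ j" by blast
    have "continuous_on ?S h"
      by (rule continuous_on_subset[OF euler_class_continuous[OF h(1)]]) auto
    then have "continuous_on ?S (\<lambda>x. h x / x ^ j)" by (intro continuous_intros) auto
    then show ?thesis unfolding Suc using h(2) by (subst continuous_on_cong[OF refl]) auto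
  qed (use uc in simp)
  have diff: "nth_deriv_on ?S i u differentiable_on ?S" if "i < q + 1" for i
  proof (cases i)
    case 0
    have "u differentiable (at x within ?S)" if "x \<in> ?S" for x
      unfolding real_differentiable_def using u[OF that] by blast
    then show ?thesis using 0 by (simp add: differentiable_on_def)
  next
    case (Suc j)
    then have j: "j \<le> q" "q - j = Suc (q - Suc j)" using that by auto
    obtain L h where h: "euler_class ?b 0 (Suc (q - Suc j)) L h"
      "\<And>x. x \<in> ?S \<Longrightarrow> nth_deriv_on ?S (Suc j) u x = h x / x ^ j"
      using pre[OF j(1)] unfolding j(2) by blast
    show ?thesis unfolding Suc differentiable_on_def real_differentiable_def
      by (rule euler_quotient_derivative[OF h]) blast+
  qed
  show "u \<in> Ck (q + 1) ?S" using cont diff by (simp add: Ck_def)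
  obtain p where p: "q = Suc p" using q by (cases q) auto
  have nv: "v x - v0 = (v x - v0) / x ^ 0" for x by simp
  obtain M w where w: "euler_class ?b 1 p M w"
    "\<And>x. x \<in> ?S \<Longrightarrow> ((\<lambda>x. v x - v0) has_real_derivative w x / x ^ Suc 0) (at x within ?S)"
    using euler_quotient_derivative[OF dv[unfolded p] nv] by metis
  have n2: "nth_deriv_on ?S 2 u x = w x / x ^ 1" if x: "x \<in> ?S" for x
  proof -
    have "(v has_real_derivative w x / x ^ 1) (at x within ?S)"
      using DERIV_add[OF w(2)[OF x] DERIV_const[of v0]] by simp
    then have "(nth_deriv_on ?S (Suc 0) u has_real_derivative w x / x ^ 1) (at x within ?S)"
      by (rule has_field_derivative_transform_within[where d = 1])
        (use x n1 in auto)
    then show ?thesis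
      using vector_derivative_left_open[OF _ x] by (simp add: numeral_2_eq_2 nth_deriv_on_Suc[of _ "Suc 0"])
  qed
  have each: "\<exists>C. \<forall>x\<in>?S. \<bar>nth_deriv_on ?S i u x\<bar> \<le> C * x powr (\<delta> - real i)"
    if i: "i \<in> {2..q + 1}" for i
  proof -
    define j where "j = i - 2"
    have ij: "i = 2 + j" "j \<le> p" using i p by (auto simp: j_def)
    obtain C h where h: "euler_class ?b 1 (p - j) C h"
      "\<And>x. x \<in> ?S \<Longrightarrow> nth_deriv_on ?S i u x = h x / x ^ (1 + j)"
      using euler_quotient_nth_deriv[OF w(1) n2 ij(2)] unfolding ij by blast
    have "\<bar>nth_deriv_on ?S i u x\<bar> \<le> C * x powr (\<delta> - real i)" if x: "x \<in> ?S" for x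
    proof -
      have e: "\<delta> - real i = ?b - real (1 + j)" by (simp add: ij)
      have p: "x ^ (1 + j) = x powr real (1 + j)" using x by (intro powr_realpow[symmetric]) auto
      have "\<bar>nth_deriv_on ?S i u x\<bar> = \<bar>h x\<bar> / x powr real (1 + j)"
        unfolding h(2)[OF x] p abs_divide by simp
      also have "\<dots> \<le> C * x powr ?b / x powr real (1 + j)"
        using euler_class_bound[OF h(1), of x] x by (intro divide_right_mono) auto
      also have "\<dots> = C * x powr (\<delta> - real i)"
        by (simp only: e powr_diff times_divide_eq_right)
      finally show ?thesis .
    qed
    then show ?thesis by blast
  qed
  then obtain C where C: "\<And>i x. i \<in> {2..q + 1} \<Longrightarrow> x \<in> ?S \<Longrightarrow>
      \<bar>nth_deriv_on ?S i u x\<bar> \<le> C i * x powr (\<delta> - real i)" by metis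
  have "\<bar>nth_deriv_on ?S i u x\<bar> \<le> (\<Sum>i\<in>{2..q + 1}. \<bar>C i\<bar>) * x powr (\<delta> - real i)"
    if "i \<in> {2..q + 1}" "x \<in> ?S" for i x
  proof -
    have "C i \<le> (\<Sum>i\<in>{2..q + 1}. \<bar>C i\<bar>)"
      using member_le_sum[of i "{2..q + 1}" "\<lambda>i. \<bar>C i\<bar>"] that by auto
    then show ?thesis using C[OF that] mult_right_mono[of "C i" _ "x powr (\<delta> - real i)"] by fastforce
  qed
  then show "\<exists>C. \<forall>x\<in>?S. \<forall>i\<in>{2..q + 1}. \<bar>nth_deriv_on ?S i u x\<bar> \<le> C * x powr (\<delta> - real i)" by blast
qed

section \<open>Initial values and the two boundary conditions\<close>

text \<open>
  The inhomogeneous term h of the equation v = h + T v that belongs to the initial values u0 of the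
  solution and v0 of its derivative.
\<close>

definition initial_forcing ::
  "real \<Rightarrow> (real \<Rightarrow> real) \<Rightarrow> (real \<Rightarrow> real) \<Rightarrow> real \<Rightarrow> real \<Rightarrow> real \<Rightarrow> real" where
  "initial_forcing \<beta> c f u0 v0 x = v0 + u0 * frac_int \<beta> c x - frac_int \<beta> f x"

lemma frac_int_rhs:
  assumes \<beta>: "0 < \<beta>" and c: "continuous_on {0..1} b" "continuous_on {0..1} c"
    "continuous_on {0..1} f" "continuous_on {0..1} v"
    and u: "\<And>x. x \<in> {0..1} \<Longrightarrow> u x = u0 + frac_int 1 v x" and x: "x \<in> {0..1}"
  shows "v0 + frac_int \<beta> (\<lambda>x. b x * v x + c x * u x - f x) x =
    initial_forcing \<beta> c f u0 v0 x + volterra \<beta> b c v x"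
proof -
  let ?V = "\<lambda>x. b x * v x + c x * frac_int 1 v x"
  have V: "continuous_on {0..1} ?V" by (intro volterra_integrand_continuous c)
  have "frac_int \<beta> (\<lambda>x. b x * v x + c x * u x - f x) x =
        frac_int \<beta> (\<lambda>x. (?V x + u0 * c x) - f x) x"
    by (rule frac_int_cong[OF \<beta> _ x]) (simp add: u algebra_simps)
  also have "\<dots> = frac_int \<beta> (\<lambda>x. ?V x + u0 * c x) x - frac_int \<beta> f x"
    by (intro frac_int_diff \<beta> x c continuous_on_add continuous_on_mult continuous_on_const V
        frac_int_continuous zero_less_one)
  also have "frac_int \<beta> (\<lambda>x. ?V x + u0 * c x) x = frac_int \<beta> ?V x + frac_int \<beta> (\<lambda>x. u0 * c x) x"
    by (rule frac_int_add[OF \<beta> V _ x]) (intro continuous_on_mult continuous_on_const c)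
  finally show ?thesis by (simp add: initial_forcing_def volterra_def frac_int_cmult)
qed

lemma Ck_1_unit_iff:
  "u \<in> Ck 1 {0..1} \<longleftrightarrow> (\<exists>v. continuous_on {0..1} v \<and>
     (\<forall>x\<in>{0..1}. (u has_real_derivative v x) (at x within {0..1})))" (is "_ \<longleftrightarrow> ?R")
proof
  assume u: "u \<in> Ck 1 {0..1}"
  have "(u has_real_derivative nth_deriv_on {0..1} 1 u x) (at x within {0..1})" if "x \<in> {0..1}" for x
  proof -
    have "u differentiable (at x within {0..1})"
      using u that by (auto simp: Ck_def differentiable_on_def)
    then show ?thesis
      by (simp add: nth_deriv_on_Suc has_real_derivative_iff_has_vector_derivative vector_derivative_works)
  qed
  moreover have "continuous_on {0..1} (nth_deriv_on {0..1} 1 u)"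
    using u unfolding Ck_def by blast
  ultimately show ?R by blast
next
  assume ?R
  then obtain v where v: "continuous_on {0..1} v"
    "\<forall>x\<in>{0..1}. (u has_real_derivative v x) (at x within {0..1})" by blast
  have "continuous_on {0..1} (nth_deriv_on {0..1} 1 u)"
    using v(1) by (rule continuous_on_eq) (rule nth_deriv_on_unit[OF v(2), symmetric])
  moreover have "continuous_on {0..1} u" by (rule DERIV_continuous_on[OF bspec[OF v(2)]])
  moreover have "u differentiable_on {0..1}"
    unfolding differentiable_on_def real_differentiable_def using v(2) by blast
  ultimately show "u \<in> Ck 1 {0..1}" by (auto simp: Ck_def le_Suc_eq)
qed

lemma caputo_bvp_solution_iff:
  assumes \<delta>: "1 < \<delta>" "\<delta> < 2" and bcf: "continuous_on {0..1} b" "continuous_on {0..1} c"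
    "continuous_on {0..1} f" and v: "continuous_on {0..1} v"
    and u: "\<forall>x\<in>{0..1}. (u has_real_derivative v x) (at x within {0..1})"
  shows "caputo_bvp_solution \<delta> b c f \<alpha>0 \<alpha>1 \<gamma>0 \<gamma>1 u \<longleftrightarrow>
    (\<forall>x\<in>{0..1}. v x = initial_forcing (\<delta> - 1) c f (u 0) (v 0) x + volterra (\<delta> - 1) b c v x) \<and>
    u 0 - \<alpha>0 * v 0 = \<gamma>0 \<and> u 1 + \<alpha>1 * v 1 = \<gamma>1"
proof -
  let ?g = "\<lambda>x. b x * v x + c x * u x - f x"
  have uv: "nth_deriv_on {0..1} 1 u x = v x" if "x \<in> {0..1}" for x
    by (rule nth_deriv_on_unit[OF u that])
  have "continuous_on {0..1} u" by (rule DERIV_continuous_on[OF bspec[OF u]])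
  then have g: "continuous_on {0..1} ?g" by (intro continuous_on_diff continuous_on_add continuous_on_mult bcf v)
  have "(\<forall>x\<in>{0<..<1}. caputo_differentiable \<delta> u x \<and>
        - caputo_deriv \<delta> u x + b x * nth_deriv_on {0..1} 1 u x + c x * u x = f x) \<longleftrightarrow>
      (\<forall>x\<in>{0<..<1}. caputo_differentiable \<delta> u x \<and> caputo_deriv \<delta> u x = ?g x)"
    by (intro ball_cong refl conj_cong) (auto simp: uv[unfolded One_nat_def])
  also have "\<dots> \<longleftrightarrow> (\<forall>x\<in>{0..1}. v x = v 0 + frac_int (\<delta> - 1) ?g x)"
    by (rule caputo_volterra_iff[OF \<delta> v u g])
  also have "\<dots> \<longleftrightarrow> (\<forall>x\<in>{0..1}. v x = initial_forcing (\<delta> - 1) c f (u 0) (v 0) x + volterra (\<delta> - 1) b c v x)"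
    using frac_int_1_of_derivative[OF v u] \<delta>
    by (intro ball_cong refl arg_cong2[of _ _ _ _ "(=)"] frac_int_rhs bcf v) auto
  finally show ?thesis unfolding caputo_bvp_solution_def using uv[of 0] uv[of 1] by simp
qed

lemma initial_value_solution_exists:
  assumes \<beta>: "0 < \<beta>" "\<beta> \<le> 1" and b: "euler_class \<beta> 0 q B b" and c: "euler_class \<beta> 0 q C c"
    and f: "euler_class \<beta> 0 q F f"
  obtains v L where "euler_class \<beta> 0 q L v"
    "\<And>x. x \<in> {0..1} \<Longrightarrow> v x = initial_forcing \<beta> c f u0 v0 x + volterra \<beta> b c v x"
proof -
  have J: "\<exists>K. euler_class \<beta> 0 q K (frac_int \<beta> g)" if "euler_class \<beta> 0 q G g" for g G
    using euler_class_weight_0[OF less_imp_le[OF \<beta>(1)] euler_class_frac_int[OF \<beta> that]] by blast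
  obtain C' F' where "euler_class \<beta> 0 q C' (frac_int \<beta> c)" "euler_class \<beta> 0 q F' (frac_int \<beta> f)"
    using J c f by metis
  then have "euler_class \<beta> 0 q ((\<bar>v0\<bar> + \<bar>u0\<bar> * C') + \<bar>-1\<bar> * F')
      (\<lambda>x. (v0 + u0 * frac_int \<beta> c x) + - 1 * frac_int \<beta> f x)"
    by (intro euler_class_add euler_class_cmult euler_class_const order_refl)
  then have "euler_class \<beta> 0 q ((\<bar>v0\<bar> + \<bar>u0\<bar> * C') + \<bar>-1\<bar> * F') (initial_forcing \<beta> c f u0 v0)"
    by (rule euler_class_cong) (simp add: initial_forcing_def)
  from volterra_solution_exists[OF \<beta> b c this] that show ?thesis by metis
qed

lemma initial_value_derivative_0:
  assumes "\<And>x. x \<in> {0..1} \<Longrightarrow> v x = initial_forcing \<beta> c f u0 v0 x + volterra \<beta> b c v x"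
  shows "v 0 = v0"
  using assms[of 0] by (simp add: initial_forcing_def volterra_def)

text \<open>
  Up to a zero y before which v is nonnegative, the primitive u = u0 + J^1 v is nonnegative as well,
  and at y the term with b drops out. Hence g y = c y * u y \<ge> 0.
\<close>

lemma homogeneous_solution_positive:
  assumes \<beta>: "0 < \<beta>" "\<beta> < 1" and b: "continuous_on {0..1} b" and c: "continuous_on {0..1} c"
    and c0: "\<forall>x\<in>{0..1}. 0 \<le> c x" and v: "euler_class \<beta> 0 (Suc q) L v"
    and eq: "\<And>x. x \<in> {0..1} \<Longrightarrow> v x = initial_forcing \<beta> c (\<lambda>x. 0) u0 1 x + volterra \<beta> b c v x"
    and u0: "0 \<le> u0" and x: "x \<in> {0..1}"
  shows "0 < v x"
proof (rule volterra_solution_positive[OF \<beta> _ _ _ zero_less_one _ x])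
  let ?u = "\<lambda>x. u0 + frac_int 1 v x"
  let ?g = "\<lambda>x. b x * v x + c x * ?u x - 0"
  have vc: "continuous_on {0..1} v" by (rule euler_class_continuous[OF v])
  show "euler_class \<beta> 0 (Suc 0) L v" by (rule euler_class_mono_order[OF v]) simp
  show "continuous_on {0..1} ?g"
    by (intro continuous_on_diff continuous_on_add continuous_on_mult continuous_on_const
        frac_int_continuous b c vc zero_less_one)
  show "v y = 1 + frac_int \<beta> ?g y" if "y \<in> {0..1}" for y
    using frac_int_rhs[OF \<beta>(1) b c continuous_on_const vc _ that, of ?u u0 1 0] eq[OF that] by simp
  fix y :: real assume y: "y \<in> {0..1}" "v y = 0" "\<And>t. t \<in> {0..y} \<Longrightarrow> 0 \<le> v t"
  have "0 \<le> frac_int 1 v y"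
    unfolding frac_int_1_eq[OF vc y(1)]
    by (rule integral_nonneg) (use y vc in \<open>auto intro!: integrable_continuous_real intro: continuous_on_subset\<close>)
  then show "0 \<le> ?g y" using y c0 u0 by simp
qed

lemma initial_forcing_linear:
  "initial_forcing \<beta> c f u0 v0 x + s * initial_forcing \<beta> c (\<lambda>x. 0) u1 v1 x =
   initial_forcing \<beta> c f (u0 + s * u1) (v0 + s * v1) x"
proof -
  have "frac_int \<beta> (\<lambda>x. 0) x = 0" by (simp add: frac_int_def)
  then show ?thesis by (simp add: initial_forcing_def algebra_simps)
qed

lemma initial_value_superposition:
  assumes \<beta>: "0 < \<beta>" and b: "continuous_on {0..1} b" and c: "continuous_on {0..1} c"
    and v: "continuous_on {0..1} v" and w: "continuous_on {0..1} w"
    and veq: "\<And>x. x \<in> {0..1} \<Longrightarrow> v x = initial_forcing \<beta> c f u0 v0 x + volterra \<beta> b c v x"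
    and weq: "\<And>x. x \<in> {0..1} \<Longrightarrow> w x = initial_forcing \<beta> c (\<lambda>x. 0) u1 v1 x + volterra \<beta> b c w x"
    and x: "x \<in> {0..1}"
  shows "v x + s * w x = initial_forcing \<beta> c f (u0 + s * u1) (v0 + s * v1) x +
     volterra \<beta> b c (\<lambda>x. v x + s * w x) x"
proof -
  have "volterra \<beta> b c (\<lambda>x. v x + s * w x) x = volterra \<beta> b c v x + s * volterra \<beta> b c w x"
    using volterra_add[OF \<beta> b c v continuous_on_mult[OF continuous_on_const w] x] by (simp add: volterra_cmult)
  then show ?thesis
    using veq[OF x] weq[OF x] initial_forcing_linear[of \<beta> c f u0 v0 x s u1 v1] by (simp add: distrib_left)
qed

lemma initial_value_unique:
  assumes \<beta>: "0 < \<beta>" "\<beta> \<le> 1" and b: "continuous_on {0..1} b" and c: "continuous_on {0..1} c"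
    and v: "continuous_on {0..1} v" and w: "continuous_on {0..1} w"
    and veq: "\<And>x. x \<in> {0..1} \<Longrightarrow> v x = initial_forcing \<beta> c f u0 v0 x + volterra \<beta> b c v x"
    and weq: "\<And>x. x \<in> {0..1} \<Longrightarrow> w x = initial_forcing \<beta> c f u0 v0 x + volterra \<beta> b c w x"
    and x: "x \<in> {0..1}"
  shows "v x = w x"
proof -
  have "v x + - 1 * w x = 0"
  proof (rule volterra_homogeneous_unique[OF \<beta> b c _ _ x])
    show "continuous_on {0..1} (\<lambda>x. v x + - 1 * w x)"
      by (intro continuous_on_add continuous_on_mult continuous_on_const v w)
    show "v y + - 1 * w y = volterra \<beta> b c (\<lambda>x. v x + - 1 * w x) y" if y: "y \<in> {0..1}" for y
      using volterra_add[OF \<beta>(1) b c v continuous_on_mult[OF continuous_on_const w, of "-1"] y]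
        volterra_cmult[of \<beta> b c "-1" w y] veq[OF y] weq[OF y] by simp
  qed
  then show ?thesis by simp
qed

theorem corollary3p1:
  fixes \<delta> \<mu> \<alpha>0 \<alpha>1 \<gamma>0 \<gamma>1 :: real and q :: nat and b c f :: "real \<Rightarrow> real"
  assumes "1 < \<delta>" and "\<delta> < 2"
    and "q \<ge> 2" and "\<mu> \<le> 2 - \<delta>"
    and "b \<in> Cq_weighted q \<mu>" and "c \<in> Cq_weighted q \<mu>" and "f \<in> Cq_weighted q \<mu>"
    and "\<forall>x\<in>{0..1}. c x \<ge> 0"
    and "\<alpha>1 \<ge> 0" and "\<alpha>0 \<ge> 1 / (\<delta> - 1)"
  shows "\<exists>u. u \<in> Ck 1 {0..1} \<inter> Ck (q + 1) {0<..1} \<and>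
             caputo_bvp_solution \<delta> b c f \<alpha>0 \<alpha>1 \<gamma>0 \<gamma>1 u \<and>
             (\<forall>v. v \<in> Ck 1 {0..1} \<inter> Ck (q + 1) {0<..1} \<and>
                  caputo_bvp_solution \<delta> b c f \<alpha>0 \<alpha>1 \<gamma>0 \<gamma>1 v
                  \<longrightarrow> (\<forall>x\<in>{0..1}. v x = u x)) \<and>
             (\<exists>C. \<forall>x\<in>{0<..1}.
                (\<forall>i\<in>{0, 1}. \<bar>nth_deriv_on {0<..1} i u x\<bar> \<le> C) \<and>
                (\<forall>i\<in>{2..q + 1}. \<bar>nth_deriv_on {0<..1} i u x\<bar> \<le> C * x powr (\<delta> - real i)))"
proof -
  define \<beta> where "\<beta> = \<delta> - 1"
  have \<beta>: "0 < \<beta>" "\<beta> < 1" "\<beta> \<le> 1" "\<mu> \<le> 1 - \<beta>" using assms by (auto simp: \<beta>_def)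
  have \<delta>: "1 < \<delta>" "\<delta> < 2" by fact+
  have "0 < 1 / (\<delta> - 1)" using \<delta> by simp
  then have \<alpha>0: "0 < \<alpha>0" using \<open>\<alpha>0 \<ge> 1 / (\<delta> - 1)\<close> by linarith
  obtain B where B: "euler_class \<beta> 0 q B b" by (rule Cq_weighted_imp_euler_class[OF \<beta>(1,2,4) assms(5)])
  obtain C where C: "euler_class \<beta> 0 q C c" by (rule Cq_weighted_imp_euler_class[OF \<beta>(1,2,4) assms(6)])
  obtain F where F: "euler_class \<beta> 0 q F f" by (rule Cq_weighted_imp_euler_class[OF \<beta>(1,2,4) assms(7)])
  have bc: "continuous_on {0..1} b" and cc: "continuous_on {0..1} c" and fc: "continuous_on {0..1} f"
    using B C F by (auto dest: euler_class_continuous)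
  obtain w L where w: "euler_class \<beta> 0 q L w"
    "\<And>x. x \<in> {0..1} \<Longrightarrow> w x = initial_forcing \<beta> c (\<lambda>x. 0) \<alpha>0 1 x + volterra \<beta> b c w x"
    using initial_value_solution_exists[OF \<beta>(1,3) B C euler_class_const[of 0 0]] by (metis abs_zero order_refl)
  obtain p M where p: "euler_class \<beta> 0 q M p"
    "\<And>x. x \<in> {0..1} \<Longrightarrow> p x = initial_forcing \<beta> c f \<gamma>0 0 x + volterra \<beta> b c p x"
    using initial_value_solution_exists[OF \<beta>(1,3) B C F] by metis
  have wc: "continuous_on {0..1} w" and pc: "continuous_on {0..1} p"
    using w p by (auto dest: euler_class_continuous)
  obtain r where r: "q = Suc r" using \<open>q \<ge> 2\<close> by (cases q) auto
  have wpos: "0 < w x" if "x \<in> {0..1}" for x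
    by (rule homogeneous_solution_positive[OF \<beta>(1,2) bc cc _ w(1)[unfolded r] w(2) _ that])
      (use assms(8) \<alpha>0 in auto)
  \<comment> \<open>The right boundary functional on the homogeneous solution. Its positivity makes the
    condition at 1 uniquely solvable for the initial slope.\<close>
  define E where "E = \<alpha>0 + frac_int 1 w 1 + \<alpha>1 * w 1"
  have "0 \<le> frac_int 1 w 1"
    unfolding frac_int_1_eq[OF wc, of 1, simplified]
    by (rule integral_nonneg) (use wc wpos in \<open>auto intro!: integrable_continuous_real less_imp_le\<close>)
  moreover have "0 \<le> \<alpha>1 * w 1" using wpos[of 1] \<open>\<alpha>1 \<ge> 0\<close> by simp
  ultimately have E: "0 < E" using \<alpha>0 by (simp add: E_def)
  define s where "s = (\<gamma>1 - (\<gamma>0 + frac_int 1 p 1 + \<alpha>1 * p 1)) / E"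
  define v where "v x = p x + s * w x" for x
  define u0 where "u0 = \<gamma>0 + s * \<alpha>0"
  define u where "u x = u0 + frac_int 1 v x" for x
  have veq: "v x = initial_forcing \<beta> c f u0 s x + volterra \<beta> b c v x" if "x \<in> {0..1}" for x
    using initial_value_superposition[OF \<beta>(1) bc cc pc wc p(2) w(2) that, of s] that
    unfolding v_def[symmetric] by (simp add: u0_def)
  have v0: "v 0 = s" by (rule initial_value_derivative_0[OF veq])
  have vE: "euler_class \<beta> 0 q (M + \<bar>s\<bar> * L) v"
    unfolding v_def by (intro euler_class_add euler_class_cmult p w)
  have vc: "continuous_on {0..1} v" by (rule euler_class_continuous[OF vE])
  have du: "\<forall>x\<in>{0..1}. (u has_real_derivative v x) (at x within {0..1})"
    unfolding u_def using frac_int_1_derivative[OF vc] by (auto intro!: derivative_eq_intros)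
  have v1: "frac_int 1 v 1 = frac_int 1 p 1 + s * frac_int 1 w 1"
    unfolding v_def using frac_int_add[of 1 p "\<lambda>x. s * w x" 1] pc wc
    by (simp add: frac_int_cmult continuous_on_mult)
  have right: "u 1 + \<alpha>1 * v 1 = \<gamma>1"
  proof -
    have "u 1 + \<alpha>1 * v 1 = (\<gamma>0 + frac_int 1 p 1 + \<alpha>1 * p 1) + s * E"
      unfolding u_def v1 u0_def E_def by (simp add: v_def algebra_simps)
    then show ?thesis using E by (simp add: s_def)
  qed
  have sol: "caputo_bvp_solution \<delta> b c f \<alpha>0 \<alpha>1 \<gamma>0 \<gamma>1 u"
    unfolding caputo_bvp_solution_iff[OF \<delta> bc cc fc vc du] \<beta>_def[symmetric]
    using veq v0 right by (simp add: u_def u0_def)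
  have unique: "y x = u x" if y: "y \<in> Ck 1 {0..1}" "caputo_bvp_solution \<delta> b c f \<alpha>0 \<alpha>1 \<gamma>0 \<gamma>1 y"
    and x: "x \<in> {0..1}" for y x
  proof -
    obtain z where z: "continuous_on {0..1} z"
      "\<forall>x\<in>{0..1}. (y has_real_derivative z x) (at x within {0..1})"
      using y(1) unfolding Ck_1_unit_iff by blast
    have zs: "\<And>x. x \<in> {0..1} \<Longrightarrow> z x = initial_forcing \<beta> c f (y 0) (z 0) x + volterra \<beta> b c z x"
      "y 0 - \<alpha>0 * z 0 = \<gamma>0" "y 1 + \<alpha>1 * z 1 = \<gamma>1"
      using y(2) unfolding caputo_bvp_solution_iff[OF \<delta> bc cc fc z] \<beta>_def[symmetric] by blast+
    \<comment> \<open>By the left condition, any other solution differs from u by e times the homogeneous one.\<close>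
    define e where "e = z 0 - s"
    have y0: "y 0 = u0 + e * \<alpha>0" "z 0 = s + e * 1"
      using zs(2) by (simp_all add: u0_def e_def algebra_simps)
    have zv: "z x = v x + e * w x" if "x \<in> {0..1}" for x
    proof (rule initial_value_unique[OF \<beta>(1,3) bc cc z(1) _ zs(1) _ that])
      show "continuous_on {0..1} (\<lambda>x. v x + e * w x)"
        by (intro continuous_on_add continuous_on_mult continuous_on_const vc wc)
      show "v x + e * w x = initial_forcing \<beta> c f (y 0) (z 0) x + volterra \<beta> b c (\<lambda>x. v x + e * w x) x"
        if "x \<in> {0..1}" for x
        unfolding y0 by (rule initial_value_superposition[OF \<beta>(1) bc cc vc wc veq w(2) that])
    qed
    have yu: "y x = u x + e * (\<alpha>0 + frac_int 1 w x)" if x: "x \<in> {0..1}" for x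
    proof -
      have "y x = y 0 + frac_int 1 z x" using frac_int_1_of_derivative[OF z x] by simp
      also have "frac_int 1 z x = frac_int 1 (\<lambda>x. v x + e * w x) x"
        by (rule frac_int_cong[OF zero_less_one zv x])
      also have "\<dots> = frac_int 1 v x + e * frac_int 1 w x"
        using frac_int_add[of 1 v "\<lambda>x. e * w x" x] vc wc x by (simp add: frac_int_cmult continuous_on_mult)
      finally show ?thesis by (simp add: y0 u_def algebra_simps)
    qed
    have "e * E = (y 1 + \<alpha>1 * z 1) - (u 1 + \<alpha>1 * v 1)"
      using yu[of 1] zv[of 1] by (simp add: E_def algebra_simps)
    then have "e = 0" using zs(3) right E by simp
    then show ?thesis using yu[OF x] by simp
  qed
  have uc: "continuous_on {0..1} u" by (rule DERIV_continuous_on[OF bspec[OF du]])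
  let ?g = "\<lambda>x. b x * v x + c x * u x - f x"
  have "euler_class \<beta> 0 q (\<bar>u0\<bar> + 2 ^ q * (M + \<bar>s\<bar> * L)) u"
    unfolding u_def by (intro euler_class_add euler_class_const euler_class_frac_int_1 \<beta> vE order_refl)
  note uE = this
  \<comment> \<open>Since v - v 0 is a fractional integral of order \<beta>, it has weight 1.\<close>
  have "\<exists>G. euler_class \<beta> 0 q G (\<lambda>x. b x * v x + c x * u x)"
    using euler_class_add[OF euler_class_mult[OF B vE] euler_class_mult[OF C uE]] by auto
  then obtain H where "euler_class \<beta> 0 q H (\<lambda>x. b x * v x + c x * u x)" by blast
  from euler_class_add[OF this euler_class_cmult[OF F, of "-1"]]
  obtain G where "euler_class \<beta> 0 q G ?g" by auto
  from euler_class_frac_int[OF \<beta>(1,3) this]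
  obtain N where N: "euler_class \<beta> 1 q N (frac_int \<beta> ?g)" by auto
  have dv: "euler_class \<beta> 1 q N (\<lambda>x. v x - s)"
  proof (rule euler_class_cong[OF N])
    show "v x - s = frac_int \<beta> ?g x" if "x \<in> {0..1}" for x
      using frac_int_rhs[OF \<beta>(1) bc cc fc vc _ that, of u u0 s] veq[OF that] by (simp add: u_def)
  qed
  have duS: "(u has_real_derivative v x) (at x within {0<..1})" if "x \<in> {0<..1}" for x
    by (rule has_field_derivative_subset[OF bspec[OF du]]) (use that in auto)
  have ucS: "continuous_on {0<..1} u" by (rule continuous_on_subset[OF uc]) auto
  note reg = euler_class_primitive_regular[OF \<delta>(1) vE[unfolded \<beta>_def] dv[unfolded \<beta>_def] _ ucS duS]
  obtain D where D: "\<And>x i. x \<in> {0<..1} \<Longrightarrow> i \<in> {2..q + 1} \<Longrightarrow>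
      \<bar>nth_deriv_on {0<..1} i u x\<bar> \<le> D * x powr (\<delta> - real i)"
    using reg(2) r by blast
  obtain U V where U: "\<And>x. x \<in> {0..1} \<Longrightarrow> \<bar>u x\<bar> \<le> U" and V: "\<And>x. x \<in> {0..1} \<Longrightarrow> \<bar>v x\<bar> \<le> V"
    using euler_class_bound[OF uE] euler_class_bound[OF vE] by auto
  define K where "K = max D (max U V)"
  have "(\<forall>i\<in>{0, 1}. \<bar>nth_deriv_on {0<..1} i u x\<bar> \<le> K) \<and>
      (\<forall>i\<in>{2..q + 1}. \<bar>nth_deriv_on {0<..1} i u x\<bar> \<le> K * x powr (\<delta> - real i))"
    if x: "x \<in> {0<..1}" for x
  proof -
    have "nth_deriv_on {0<..1} (Suc 0) u x = v x"
      using vector_derivative_left_open[OF duS[OF x] x] by (simp add: nth_deriv_on_Suc)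
    then have "\<forall>i\<in>{0, 1}. \<bar>nth_deriv_on {0<..1} i u x\<bar> \<le> K"
      using U[of x] V[of x] x by (auto simp: K_def)
    moreover have "\<bar>nth_deriv_on {0<..1} i u x\<bar> \<le> K * x powr (\<delta> - real i)" if "i \<in> {2..q + 1}" for i
      using D[OF x that] mult_right_mono[of D K "x powr (\<delta> - real i)"] by (fastforce simp: K_def)
    ultimately show ?thesis by blast
  qed
  moreover have "u \<in> Ck 1 {0..1}" unfolding Ck_1_unit_iff using vc du by blast
  moreover have "u \<in> Ck (q + 1) {0<..1}" using reg(1) r by simp
  ultimately show ?thesis using sol unique by blast
qed

end
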